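(* There are unique positive Borel measures $\mu_\pm$ on $\Gamma_\pm$ such that, for any $0<T<\infty$ and any $f\in L^1(\Omega_T,\mu_T)$, $$\int_{\Omega_T}f(x,t)\,d\mu_T(x,t)=\int_0^Tdt\int_{\Gamma_+}d\mu_+(y)\int_0^{\tau_-(y)\wedge t}f(\Phi(y,-s),t-s)\,ds+\int_\Omega d\mu(x)\int_0^{\tau_-(x)\wedge T}f(\Phi(x,-s),T-s)\,ds,$$ and $$\int_{\Omega_T}f(x,t)\,d\mu_T(x,t)=\int_0^Tdt\int_{\Gamma_-}d\mu_-(y)\int_0^{\tau_+(y)\wedge(T-t)}f(\Phi(y,s),t+s)\,ds+\int_\Omega d\mu(x)\int_0^{\tau_+(x)\wedge T}f(\Phi(x,s),s)\,ds .$$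
   Context: Setting. $\mu$ is a positive Radon measure on $\mathbb R^N$ (a Borel measure, or the completion of one, finite on compact sets). $F:\mathbb R^N\to\mathbb R^N$ is a globally Lipschitz vector field. For $x\in\mathbb R^N$, $t\mapsto\Phi(x,t)$, $t\in\mathbb R$, is the unique global solution of $\frac{d}{dt}X(t)=F(X(t))$, $X(0)=x$. Standing assumption: $\mu(\Phi(A,t))=\mu(A)$ for every measurable $A\subset\mathbb R^N$ and $t\in\mathbb R$. $\Omega\subset\mathbb R^N$ is a (sufficiently smooth) open set. For $x\in\Omega$, $\tau_\pm(x)=\inf\{s>0:\Phi(x,\pm s)\notin\Omega\}$, with $\inf\varnothing=\infty$. The incoming ($-$) and outgoing ($+$) boundaries are $\Gamma_\pm=\{y\in\partial\Omega:\exists x\in\Omega,\ \tau_\pm(x)<\infty,\ y=\Phi(x,\pm\tau_\pm(x))\}$. For $y\in\Gamma_-$ (resp. $y\in\Gamma_+$), $\tau_+(y)$ (resp. $\tau_-(y)$) is the length of the integral curve in $\Omega$ having $y$ as left (resp. right) endpoint, i.e. $\tau_-(x)+\tau_+(x)$ for any $x\in\Omega$ with $y=\Phi(x,-\tau_-(x))$ (resp. $y=\Phi(x,\tau_+(x))$). For $0<T<\infty$: $\Omega_T=\Omega\times(0,T)$ and $\mu_T=\mu\otimes dt$ on $\Omega_T$ ($dt$ is Lebesgue measure). $\wedge$ denotes minimum. *)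

theory Defs
  imports "HOL-Analysis.Analysis"
begin

definition radon_measure :: "'a::euclidean_space measure \<Rightarrow> bool" where
  "radon_measure \<mu> \<longleftrightarrow>
     (sets \<mu> = sets borel \<or> (\<exists>\<nu>. sets \<nu> = sets borel \<and> \<mu> = completion \<nu>)) \<and>
     (\<forall>K. compact K \<longrightarrow> emeasure \<mu> K < \<infinity>)"

definition global_flow :: "('a::euclidean_space \<Rightarrow> 'a) \<Rightarrow> ('a \<Rightarrow> real \<Rightarrow> 'a) \<Rightarrow> bool" where
  "global_flow F \<Phi> \<longleftrightarrow>
     (\<forall>x. \<Phi> x 0 = x \<and> (\<forall>t. (\<Phi> x has_vector_derivative F (\<Phi> x t)) (at t)))"

definition flow_invariant :: "'a::euclidean_space measure \<Rightarrow> ('a \<Rightarrow> real \<Rightarrow> 'a) \<Rightarrow> bool" where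
  "flow_invariant \<mu> \<Phi> \<longleftrightarrow> (\<forall>A\<in>sets \<mu>. \<forall>t. emeasure \<mu> ((\<lambda>x. \<Phi> x t) ` A) = emeasure \<mu> A)"

text \<open>
  The sign \<open>\<sigma>\<close> is \<open>1\<close> for the outgoing (\<open>+\<close>) objects and \<open>- 1\<close> for the incoming (\<open>-\<close>) ones.
  The infimum is taken in \<^typ>\<open>ereal\<close>, so that \<open>exit_time\<close> is \<open>\<infinity>\<close> if the trajectory never leaves.
\<close>

definition exit_time :: "('a::euclidean_space \<Rightarrow> real \<Rightarrow> 'a) \<Rightarrow> 'a set \<Rightarrow> real \<Rightarrow> 'a \<Rightarrow> ereal" where
  "exit_time \<Phi> \<Omega> \<sigma> x = Inf (ereal ` {s. 0 < s \<and> \<Phi> x (\<sigma> * s) \<notin> \<Omega>})"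

definition exits_at ::
    "('a::euclidean_space \<Rightarrow> real \<Rightarrow> 'a) \<Rightarrow> 'a set \<Rightarrow> real \<Rightarrow> 'a \<Rightarrow> 'a \<Rightarrow> bool" where
  "exits_at \<Phi> \<Omega> \<sigma> x y \<longleftrightarrow>
     x \<in> \<Omega> \<and> exit_time \<Phi> \<Omega> \<sigma> x < \<infinity> \<and> y = \<Phi> x (\<sigma> * real_of_ereal (exit_time \<Phi> \<Omega> \<sigma> x))"

definition exit_boundary ::
    "('a::euclidean_space \<Rightarrow> real \<Rightarrow> 'a) \<Rightarrow> 'a set \<Rightarrow> real \<Rightarrow> 'a set" where
  "exit_boundary \<Phi> \<Omega> \<sigma> = {y \<in> frontier \<Omega>. \<exists>x. exits_at \<Phi> \<Omega> \<sigma> x y}"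

text \<open>
  For \<open>y\<close> in the exit boundary, the total length \<open>\<tau>\<^sub>- x + \<tau>\<^sub>+ x\<close> of the integral curve in \<open>\<Omega>\<close>
  ending (\<open>\<sigma> = 1\<close>) or starting (\<open>\<sigma> = - 1\<close>) at \<open>y\<close>; it does not depend on the point \<open>x\<close> of the curve.
\<close>

definition curve_length ::
    "('a::euclidean_space \<Rightarrow> real \<Rightarrow> 'a) \<Rightarrow> 'a set \<Rightarrow> real \<Rightarrow> 'a \<Rightarrow> ereal" where
  "curve_length \<Phi> \<Omega> \<sigma> y =
     (THE l. \<exists>x. exits_at \<Phi> \<Omega> \<sigma> x y \<and> l = exit_time \<Phi> \<Omega> (- 1) x + exit_time \<Phi> \<Omega> 1 x)"

abbreviation tau_plus :: "('a::euclidean_space \<Rightarrow> real \<Rightarrow> 'a) \<Rightarrow> 'a set \<Rightarrow> 'a \<Rightarrow> ereal" where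
  "tau_plus \<Phi> \<Omega> \<equiv> exit_time \<Phi> \<Omega> 1"

abbreviation tau_minus :: "('a::euclidean_space \<Rightarrow> real \<Rightarrow> 'a) \<Rightarrow> 'a set \<Rightarrow> 'a \<Rightarrow> ereal" where
  "tau_minus \<Phi> \<Omega> \<equiv> exit_time \<Phi> \<Omega> (- 1)"

abbreviation Gamma_plus :: "('a::euclidean_space \<Rightarrow> real \<Rightarrow> 'a) \<Rightarrow> 'a set \<Rightarrow> 'a set" where
  "Gamma_plus \<Phi> \<Omega> \<equiv> exit_boundary \<Phi> \<Omega> 1"

abbreviation Gamma_minus :: "('a::euclidean_space \<Rightarrow> real \<Rightarrow> 'a) \<Rightarrow> 'a set \<Rightarrow> 'a set" where
  "Gamma_minus \<Phi> \<Omega> \<equiv> exit_boundary \<Phi> \<Omega> (- 1)"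

text \<open>\<open>\<tau>\<^sub>-\<close> on \<open>\<Gamma>\<^sub>+\<close> and \<open>\<tau>\<^sub>+\<close> on \<open>\<Gamma>\<^sub>-\<close>, respectively.\<close>

abbreviation tau_minus_bd :: "('a::euclidean_space \<Rightarrow> real \<Rightarrow> 'a) \<Rightarrow> 'a set \<Rightarrow> 'a \<Rightarrow> ereal" where
  "tau_minus_bd \<Phi> \<Omega> \<equiv> curve_length \<Phi> \<Omega> 1"

abbreviation tau_plus_bd :: "('a::euclidean_space \<Rightarrow> real \<Rightarrow> 'a) \<Rightarrow> 'a set \<Rightarrow> 'a \<Rightarrow> ereal" where
  "tau_plus_bd \<Phi> \<Omega> \<equiv> curve_length \<Phi> \<Omega> (- 1)"

definition borel_measure_on :: "'a::euclidean_space set \<Rightarrow> 'a measure \<Rightarrow> bool" where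
  "borel_measure_on S \<nu> \<longleftrightarrow> space \<nu> = S \<and> sets \<nu> = sets (restrict_space borel S)"

text \<open>
  Members of \<open>L\<^sup>1\<close> are only determined up to null sets, and \<open>\<mu>\<close> may or may not be complete. To treat
  all cases at once, integrability and integrals always refer to the completed measures. On functions
  measurable for the uncompleted measure this changes nothing.
\<close>

definition mu_T ::
    "'a::euclidean_space measure \<Rightarrow> 'a set \<Rightarrow> real \<Rightarrow> ('a \<times> real) measure" where
  "mu_T \<mu> \<Omega> T = restrict_space (completion (\<mu> \<Otimes>\<^sub>M lborel)) (\<Omega> \<times> {0<..<T})"

text \<open>
  Since the Bochner integral of a non-integrable function is \<open>0\<close> by convention, the existence of the
  iterated integrals (with inner integrals existing almost everywhere) has to be stated explicitly.
  Without it, uniqueness fails: for \<open>\<mu> = 0\<close> and nonempty \<open>\<Gamma>\<close>, both the zero measure and \<open>\<infinity>\<close> times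
  counting measure would satisfy the bare equations.
\<close>

definition boundary_integral_exists ::
    "real \<Rightarrow> 'a::euclidean_space measure \<Rightarrow> (real \<Rightarrow> 'a \<Rightarrow> ereal) \<Rightarrow>
     (real \<Rightarrow> 'a \<Rightarrow> real \<Rightarrow> real) \<Rightarrow> bool" where
  "boundary_integral_exists T \<nu> b g \<longleftrightarrow>
     (AE t in lebesgue. t \<in> {0<..<T} \<longrightarrow>
        (AE y in \<nu>. interval_lebesgue_integrable lebesgue 0 (b t y) (g t y)) \<and>
        integrable (completion \<nu>) (\<lambda>y. LINT s=0..b t y|lebesgue. g t y s)) \<and>
     interval_lebesgue_integrable lebesgue 0 T
       (\<lambda>t. LINT y|completion \<nu>. LINT s=0..b t y|lebesgue. g t y s)"

definition interior_integral_exists ::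
    "'a::euclidean_space set \<Rightarrow> 'a measure \<Rightarrow> ('a \<Rightarrow> ereal) \<Rightarrow> ('a \<Rightarrow> real \<Rightarrow> real) \<Rightarrow> bool" where
  "interior_integral_exists \<Omega> \<mu> b g \<longleftrightarrow>
     (AE x in \<mu>. x \<in> \<Omega> \<longrightarrow> interval_lebesgue_integrable lebesgue 0 (b x) (g x)) \<and>
     set_integrable (completion \<mu>) \<Omega> (\<lambda>x. LINT s=0..b x|lebesgue. g x s)"

end

theory Submission
  imports Defs
begin

text \<open>
  Let \<open>E\<close> be the set of points of \<open>\<Omega>\<close> whose trajectory leaves \<open>\<Omega>\<close> in finite time. Every point of \<open>E\<close> is
  determined by the point \<open>y\<close> of the outgoing boundary where it exits and the time \<open>s\<close> after which it does
  so. In these coordinates the flow is translation in \<open>s\<close>, and since \<open>\<mu>\<close> is invariant under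
  the flow, it has to be a product \<open>\<mu>\<^sub>+ \<otimes> ds\<close>. The factor \<open>\<mu>\<^sub>+\<close> can be written down directly: choose a
  weight on \<open>E\<close> whose integral along every trajectory is \<open>1\<close>, and let \<open>\<mu>\<^sub>+\<close> be the image of \<open>weight \<cdot> \<mu>\<close>
  under the exit point map (\<open>outflow\<close>). That \<open>\<mu>\<close> then is the product is an application of Tonelli's theorem
  and of invariance (\<open>nn_integral_along_trajectories\<close>).

  For nonnegative \<open>f\<close> the formula of the theorem results from following each point of
  \<open>\<Omega> \<times> {0<..<T}\<close> along its space-time trajectory until it either leaves \<open>\<Omega>\<close>, which gives the boundary
  term, or reaches time \<open>T\<close>, which gives the interior term (\<open>outgoing_formula\<close>). Integrable functions
  are measurable only for completed measures. They are reduced to nonnegative Borel functions by applying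
  the formula to the positive and negative part of a Borel version and to the indicator of the null set
  where the version differs (\<open>integral_transfer\<close>).

  Uniqueness (\<open>outflow_unique\<close>) is obtained from the test functions \<open>h x \<cdot> indicator A (exit_point x)\<close> on
  \<open>E\<close>, where \<open>h\<close> is positive, bounded and integrable. Existence of the iterated integrals forces a competing
  measure \<open>P\<close> to be \<open>\<sigma>\<close>-finite. Then the formula computes the integral over \<open>A\<close>, with respect to \<open>P\<close>, of a
  positive bounded function that does not depend on \<open>P\<close> or \<open>A\<close>.

  Reversing the direction of the flow exchanges the two boundaries, and together with the reflection
  \<open>t \<mapsto> T - t\<close> of time it turns the first formula of the theorem into the second. Therefore everything is
  proved for the outgoing boundary only.
\<close>

section \<open>The flow of a Lipschitz vector field\<close>

text \<open>
  Gronwall's inequality in its simplest form: \<open>\<parallel>X - Y\<parallel>\<^sup>2\<close> grows at most at rate \<open>2 L\<close>, so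
  \<open>e\<^bsup>- 2 L s\<^esup> \<parallel>X - Y\<parallel>\<^sup>2\<close> has nonpositive derivative.
\<close>

lemma lipschitz_solutions_forward:
  fixes F :: "'a::euclidean_space \<Rightarrow> 'a"
  assumes F: "L-lipschitz_on UNIV F"
    and X: "\<And>t. (X has_vector_derivative F (X t)) (at t)"
    and Y: "\<And>t. (Y has_vector_derivative F (Y t)) (at t)"
    and t: "0 \<le> t"
  shows "norm (X t - Y t) \<le> exp (L * t) * norm (X 0 - Y 0)"
proof -
  define u where "u s = exp (- 2 * L * s) * ((X s - Y s) \<bullet> (X s - Y s))" for s
  have du: "(u has_real_derivative
      exp (- 2 * L * s) * (2 * ((X s - Y s) \<bullet> (F (X s) - F (Y s))) - 2 * L * ((X s - Y s) \<bullet> (X s - Y s)))) (at s)" for s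
  proof -
    have D: "((\<lambda>s. X s - Y s) has_derivative (\<lambda>h. h *\<^sub>R (F (X s) - F (Y s)))) (at s)"
      using has_vector_derivative_diff[OF X Y] by (simp add: has_vector_derivative_def)
    have "((\<lambda>s. (X s - Y s) \<bullet> (X s - Y s)) has_derivative
        (\<lambda>h. (X s - Y s) \<bullet> (h *\<^sub>R (F (X s) - F (Y s))) + (h *\<^sub>R (F (X s) - F (Y s))) \<bullet> (X s - Y s))) (at s)"
      by (rule has_derivative_inner[OF D D])
    then have "((\<lambda>s. (X s - Y s) \<bullet> (X s - Y s)) has_real_derivative
        2 * ((X s - Y s) \<bullet> (F (X s) - F (Y s)))) (at s)"
      unfolding has_field_derivative_def
      by (rule has_derivative_eq_rhs) (auto simp: inner_commute algebra_simps)
    moreover have "((\<lambda>s. exp (- 2 * L * s)) has_real_derivative exp (- 2 * L * s) * (- 2 * L)) (at s)"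
      by (auto intro!: derivative_eq_intros)
    ultimately have "(u has_real_derivative exp (- 2 * L * s) * (- 2 * L) * ((X s - Y s) \<bullet> (X s - Y s))
        + 2 * ((X s - Y s) \<bullet> (F (X s) - F (Y s))) * exp (- 2 * L * s)) (at s)"
      unfolding u_def by (intro DERIV_mult)
    then show ?thesis
      by (rule DERIV_cong) (simp add: algebra_simps)
  qed
  have "u t \<le> u 0"
  proof (rule DERIV_nonpos_imp_nonincreasing[OF t])
    fix s assume "0 \<le> s" "s \<le> t"
    have "norm (F (X s) - F (Y s)) \<le> L * norm (X s - Y s)"
      using lipschitz_onD[OF F] by (simp add: dist_norm)
    then have "(X s - Y s) \<bullet> (F (X s) - F (Y s)) \<le> norm (X s - Y s) * (L * norm (X s - Y s))"
      by (meson mult_left_mono norm_cauchy_schwarz norm_ge_zero order_trans)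
    also have "\<dots> = L * ((X s - Y s) \<bullet> (X s - Y s))"
      by (simp add: dot_square_norm power2_eq_square)
    finally show "\<exists>D. (u has_real_derivative D) (at s) \<and> D \<le> 0"
      using du[of s] by (intro exI conjI) (auto simp: mult_le_0_iff)
  qed
  then have "(norm (X t - Y t))\<^sup>2 \<le> exp (2 * L * t) * (norm (X 0 - Y 0))\<^sup>2"
    unfolding u_def by (simp add: dot_square_norm exp_minus field_simps)
  also have "\<dots> = (exp (L * t) * norm (X 0 - Y 0))\<^sup>2"
    by (simp add: power_mult_distrib exp_double[symmetric] mult.assoc)
  finally show ?thesis
    by (rule power2_le_imp_le) simp
qed

text \<open>
  Negative times are positive times of the solutions of \<open>X' = - F X\<close>.
\<close>

lemma lipschitz_solutions:
  fixes F :: "'a::euclidean_space \<Rightarrow> 'a"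
  assumes F: "L-lipschitz_on UNIV F"
    and X: "\<And>t. (X has_vector_derivative F (X t)) (at t)"
    and Y: "\<And>t. (Y has_vector_derivative F (Y t)) (at t)"
  shows "norm (X t - Y t) \<le> exp (L * \<bar>t\<bar>) * norm (X 0 - Y 0)"
proof (cases "0 \<le> t")
  case True
  then show ?thesis using lipschitz_solutions_forward[OF F X Y] by simp
next
  case False
  have rev: "((\<lambda>t. Z (- t)) has_vector_derivative - F (Z (- t))) (at t)"
    if "\<And>t. (Z has_vector_derivative F (Z t)) (at t)" for Z t
    using vector_diff_chain_at[OF has_vector_derivative_minus[OF has_vector_derivative_id] that, of t]
    by (simp add: o_def)
  have "L-lipschitz_on UNIV (\<lambda>x. - F x)"
    using F by (simp add: lipschitz_on_def dist_norm norm_minus_commute)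
  from lipschitz_solutions_forward[OF this rev[OF X] rev[OF Y], of "- t"] False show ?thesis
    by simp
qed

text \<open>
  What the argument needs to know about the vector field: its trajectories form a jointly continuous
  action of the additive group of real numbers. Unlike the differential equation, these properties
  pass verbatim to the reversed flow, so every result about the outgoing boundary has a counterpart
  for the incoming one.
\<close>

locale flow_domain =
  fixes \<Phi> :: "'a::euclidean_space \<Rightarrow> real \<Rightarrow> 'a" and \<Omega> :: "'a set"
  assumes flow_0 [simp]: "\<Phi> x 0 = x"
    and flow_flow [simp]: "\<Phi> (\<Phi> x s) t = \<Phi> x (s + t)"
    and continuous_flow: "continuous_on UNIV (\<lambda>(x, t). \<Phi> x t)"
    and open_domain: "open \<Omega>"

text \<open>
  The group law is uniqueness for the differential equation, since \<open>\<lambda>t. \<Phi> x (s + t)\<close> solves it as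
  well. Joint continuity follows because \<open>\<Phi> x t\<close> depends on \<open>x\<close> in a Lipschitz way, locally
  uniformly in \<open>t\<close>.
\<close>

lemma flow_domain_lipschitz:
  assumes F: "L-lipschitz_on UNIV F" and flow: "global_flow F \<Phi>" and "open \<Omega>"
  shows "flow_domain \<Phi> \<Omega>"
proof
  have d: "(\<Phi> x has_vector_derivative F (\<Phi> x t)) (at t)" and z: "\<Phi> x 0 = x" for x t
    using flow by (auto simp: global_flow_def)
  show "\<Phi> x 0 = x" for x by (rule z)
  show "\<Phi> (\<Phi> x s) t = \<Phi> x (s + t)" for x s t
  proof -
    have "((\<lambda>t. \<Phi> x (s + t)) has_vector_derivative F (\<Phi> x (s + t))) (at t)" for t
    proof -
      have "((\<lambda>t. s + t) has_vector_derivative 1) (at t)"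
        by (auto intro!: derivative_eq_intros)
      from vector_diff_chain_at[OF this d] show ?thesis by (simp add: o_def)
    qed
    from lipschitz_solutions[OF F d this, of "\<Phi> x s" t] z show ?thesis
      by simp
  qed
  show "continuous_on UNIV (\<lambda>(x, t). \<Phi> x t)"
    unfolding continuous_on_def
  proof
    fix q :: "'a \<times> real"
    obtain a b where q: "q = (a, b)" by force
    let ?F = "at (a, b)"
    have f1: "(fst \<longlongrightarrow> a) ?F" and f2: "(snd \<longlongrightarrow> b) ?F"
      using tendsto_fst[OF tendsto_ident_at[of "(a,b)" UNIV]] tendsto_snd[OF tendsto_ident_at[of "(a,b)" UNIV]] by simp_all
    have "isCont (\<Phi> a) b"
      using d[of a b] has_vector_derivative_continuous by blast
    then have "((\<lambda>p. \<Phi> a (snd p)) \<longlongrightarrow> \<Phi> a b) ?F"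
      by (rule isCont_tendsto_compose[OF _ f2])
    moreover have "((\<lambda>p. \<Phi> (fst p) (snd p) - \<Phi> a (snd p)) \<longlongrightarrow> 0) ?F"
    proof (rule Lim_null_comparison)
      show "\<forall>\<^sub>F p in ?F. norm (\<Phi> (fst p) (snd p) - \<Phi> a (snd p)) \<le> exp (L * \<bar>snd p\<bar>) * norm (fst p - a)"
        using lipschitz_solutions[OF F d d] z by (intro always_eventually) (metis)
      have "((\<lambda>p. exp (L * \<bar>snd p\<bar>) * norm (fst p - a)) \<longlongrightarrow> exp (L * \<bar>b\<bar>) * norm (a - a)) ?F"
        by (intro tendsto_intros f1 f2)
      then show "((\<lambda>p. exp (L * \<bar>snd p\<bar>) * norm (fst p - a)) \<longlongrightarrow> 0) ?F" by simp
    qed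
    ultimately have "((\<lambda>p. (\<Phi> (fst p) (snd p) - \<Phi> a (snd p)) + \<Phi> a (snd p)) \<longlongrightarrow> 0 + \<Phi> a b) ?F"
      by (intro tendsto_add)
    then show "((\<lambda>(x, t). \<Phi> x t) \<longlongrightarrow> (case q of (x, t) \<Rightarrow> \<Phi> x t)) (at q)"
      by (simp add: q case_prod_unfold)
  qed
qed fact

section \<open>Exit times and the coordinates along the trajectories\<close>

lemma exit_time_reverse: "exit_time (\<lambda>x t. \<Phi> x (- t)) \<Omega> \<sigma> = exit_time \<Phi> \<Omega> (- \<sigma>)"
  by (simp add: exit_time_def fun_eq_iff)

context flow_domain
begin

lemma reverse: "flow_domain (\<lambda>x t. \<Phi> x (- t)) \<Omega>"
proof
  have "continuous_on UNIV ((\<lambda>(x, t). \<Phi> x t) \<circ> (\<lambda>p. (fst p, - snd p)))"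
    by (intro continuous_on_compose continuous_intros continuous_on_subset[OF continuous_flow]) auto
  then show "continuous_on UNIV (\<lambda>(x, t). \<Phi> x (- t))"
    by (simp add: o_def split_beta)
qed (use open_domain in auto)

lemma continuous_on_flow [continuous_intros]:
  "continuous_on S f \<Longrightarrow> continuous_on S g \<Longrightarrow> continuous_on S (\<lambda>z. \<Phi> (f z) (g z))"
  using continuous_on_compose2[OF continuous_flow, of S "\<lambda>z. (f z, g z)"]
  by (simp add: continuous_on_Pair)

lemma flow_measurable [measurable]:
  assumes [measurable]: "f \<in> borel_measurable M" "g \<in> borel_measurable M"
  shows "(\<lambda>z. \<Phi> (f z) (g z)) \<in> borel_measurable M"
proof -
  have "(\<lambda>(x, t). \<Phi> x t) \<in> borel_measurable borel"
    by (rule borel_measurable_continuous_onI[OF continuous_flow])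
  then have "(\<lambda>(x, t). \<Phi> x t) \<in> borel_measurable (borel \<Otimes>\<^sub>M borel)"
    by (simp add: borel_prod)
  from measurable_compose[OF _ this, of "\<lambda>z. (f z, g z)" M] show ?thesis
    by simp
qed

lemma exit_time_nonneg: "0 \<le> exit_time \<Phi> \<Omega> \<sigma> x"
  unfolding exit_time_def by (auto intro!: Inf_greatest)

lemma exit_time_cases:
  obtains "exit_time \<Phi> \<Omega> \<sigma> x = \<infinity>" | s where "0 \<le> s" "exit_time \<Phi> \<Omega> \<sigma> x = ereal s"
  using exit_time_nonneg[of \<sigma> x] by (cases "exit_time \<Phi> \<Omega> \<sigma> x") auto

text \<open>
  As \<open>\<Omega>\<close> is open, a trajectory that is in \<open>\<Omega>\<close> at time \<open>s\<close> stays there a little longer. That is why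
  the inequality on the left is strict although \<open>r = s\<close> is allowed on the right. The initial point
  itself need not be in \<open>\<Omega>\<close>, so the lemma also applies to boundary points.
\<close>

lemma less_exit_time_iff:
  assumes s: "0 < s"
  shows "ereal s < exit_time \<Phi> \<Omega> \<sigma> x \<longleftrightarrow> (\<forall>r. 0 < r \<and> r \<le> s \<longrightarrow> \<Phi> x (\<sigma> * r) \<in> \<Omega>)"
proof
  assume *: "ereal s < exit_time \<Phi> \<Omega> \<sigma> x"
  show "\<forall>r. 0 < r \<and> r \<le> s \<longrightarrow> \<Phi> x (\<sigma> * r) \<in> \<Omega>"
  proof (intro allI impI, rule ccontr)
    fix r assume "0 < r \<and> r \<le> s" "\<Phi> x (\<sigma> * r) \<notin> \<Omega>"
    then have "exit_time \<Phi> \<Omega> \<sigma> x \<le> ereal r"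
      unfolding exit_time_def by (intro Inf_lower) blast
    with * \<open>0 < r \<and> r \<le> s\<close> show False
      by (meson ereal_less_eq(3) leD order_trans)
  qed
next
  assume *: "\<forall>r. 0 < r \<and> r \<le> s \<longrightarrow> \<Phi> x (\<sigma> * r) \<in> \<Omega>"
  have "open ((\<lambda>r. \<Phi> x (\<sigma> * r)) -` \<Omega>)"
    using open_domain by (intro open_vimage) (auto intro!: continuous_intros)
  moreover have "s \<in> (\<lambda>r. \<Phi> x (\<sigma> * r)) -` \<Omega>"
    using * s by simp
  ultimately obtain e where e: "0 < e" "ball s e \<subseteq> (\<lambda>r. \<Phi> x (\<sigma> * r)) -` \<Omega>"
    by (meson open_contains_ball)
  have "\<Phi> x (\<sigma> * r) \<in> \<Omega>" if "0 < r" "r < s + e" for r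
  proof (cases "r \<le> s")
    case False
    then have "r \<in> ball s e" using that by (simp add: dist_real_def)
    then show ?thesis using e by auto
  qed (use * that in auto)
  then have "ereal (s + e) \<le> exit_time \<Phi> \<Omega> \<sigma> x"
    unfolding exit_time_def by (intro Inf_greatest) (force simp: not_less[symmetric])
  then show "ereal s < exit_time \<Phi> \<Omega> \<sigma> x"
    using e(1) by (meson ereal_less_eq(3) less_add_same_cancel1 less_ereal.simps(1) less_le_trans)
qed

lemma exit_time_pos:
  assumes "x \<in> \<Omega>" shows "0 < exit_time \<Phi> \<Omega> \<sigma> x"
proof -
  have "open ((\<lambda>r. \<Phi> x (\<sigma> * r)) -` \<Omega>)"
    using open_domain by (intro open_vimage) (auto intro!: continuous_intros)
  moreover have "0 \<in> (\<lambda>r. \<Phi> x (\<sigma> * r)) -` \<Omega>"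
    using assms by simp
  ultimately obtain e where e: "0 < e" "cball 0 e \<subseteq> (\<lambda>r. \<Phi> x (\<sigma> * r)) -` \<Omega>"
    by (meson open_contains_cball)
  have "ereal e < exit_time \<Phi> \<Omega> \<sigma> x"
    unfolding less_exit_time_iff[OF e(1)] using e(2) by (auto simp: subset_iff)
  then show ?thesis using e(1) by (metis ereal_less(2) less_trans)
qed

lemma flow_exit_time:
  assumes "exit_time \<Phi> \<Omega> \<sigma> x = ereal s" "0 < s"
  shows "\<Phi> x (\<sigma> * s) \<notin> \<Omega>"
proof
  assume "\<Phi> x (\<sigma> * s) \<in> \<Omega>"
  have "\<Phi> x (\<sigma> * r) \<in> \<Omega>" if r: "0 < r" "r < s" for r
    using less_exit_time_iff[of r \<sigma> x] assms r by auto
  then have "ereal s < exit_time \<Phi> \<Omega> \<sigma> x"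
    unfolding less_exit_time_iff[OF assms(2)] using \<open>\<Phi> x (\<sigma> * s) \<in> \<Omega>\<close>
    by (auto simp: le_less)
  then show False using assms by simp
qed

lemma exit_time_eqI:
  assumes "0 < s" "\<And>r. 0 < r \<Longrightarrow> r < s \<Longrightarrow> \<Phi> x (\<sigma> * r) \<in> \<Omega>" "\<Phi> x (\<sigma> * s) \<notin> \<Omega>"
  shows "exit_time \<Phi> \<Omega> \<sigma> x = ereal s"
proof (rule antisym)
  show "exit_time \<Phi> \<Omega> \<sigma> x \<le> ereal s"
    unfolding exit_time_def using assms by (intro Inf_lower) blast
  show "ereal s \<le> exit_time \<Phi> \<Omega> \<sigma> x"
    unfolding exit_time_def using assms(2) by (intro Inf_greatest) (force simp: not_less[symmetric])
qed

text \<open>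
  The exit time is lower semicontinuous on \<open>\<Omega>\<close>, but need not be so elsewhere. Its superlevel sets are
  however countable combinations of conditions over compact time intervals, and staying in an open set during a compact
  time interval is an open condition on the initial point.
\<close>

lemma exit_time_measurable [measurable]: "exit_time \<Phi> \<Omega> \<sigma> \<in> borel_measurable borel"
proof (rule borel_measurableI_greater)
  fix c :: ereal
  have stay: "open {x. \<forall>r\<in>{a..b}. \<Phi> x (\<sigma> * r) \<in> \<Omega>}" for a b
  proof -
    have "closed {x. \<exists>r. r \<in> {a..b} \<and> (r, x) \<in> (\<lambda>(r, x). \<Phi> x (\<sigma> * r)) -` (- \<Omega>)}"
      using open_domain
      by (intro closed_compact_projection closed_vimage) (auto simp: split_beta intro!: continuous_intros)
    then have "open (- {x. \<exists>r. r \<in> {a..b} \<and> (r, x) \<in> (\<lambda>(r, x). \<Phi> x (\<sigma> * r)) -` (- \<Omega>)})"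
      by (rule open_Compl)
    also have "- {x. \<exists>r. r \<in> {a..b} \<and> (r, x) \<in> (\<lambda>(r, x). \<Phi> x (\<sigma> * r)) -` (- \<Omega>)}
        = {x. \<forall>r\<in>{a..b}. \<Phi> x (\<sigma> * r) \<in> \<Omega>}" by auto
    finally show ?thesis .
  qed
  have gt: "{x. ereal s < exit_time \<Phi> \<Omega> \<sigma> x} \<in> sets borel" if s: "0 < s" for s
  proof -
    have "{x. ereal s < exit_time \<Phi> \<Omega> \<sigma> x} = (\<Inter>n. {x. \<forall>r\<in>{inverse (real (Suc n))..s}. \<Phi> x (\<sigma> * r) \<in> \<Omega>})"
    proof (intro set_eqI iffI)
      fix x assume "x \<in> {x. ereal s < exit_time \<Phi> \<Omega> \<sigma> x}"
      moreover have "0 < r" if "inverse (real (Suc n)) \<le> r" for r n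
      proof -
        have "0 < inverse (real (Suc n))" by simp
        with that show ?thesis by linarith
      qed
      ultimately show "x \<in> (\<Inter>n. {x. \<forall>r\<in>{inverse (real (Suc n))..s}. \<Phi> x (\<sigma> * r) \<in> \<Omega>})"
        using less_exit_time_iff[OF s, of \<sigma> x] by (auto simp del: of_nat_Suc)
    next
      fix x assume *: "x \<in> (\<Inter>n. {x. \<forall>r\<in>{inverse (real (Suc n))..s}. \<Phi> x (\<sigma> * r) \<in> \<Omega>})"
      have "\<Phi> x (\<sigma> * r) \<in> \<Omega>" if r: "0 < r" "r \<le> s" for r
      proof -
        obtain n where "inverse (real (Suc n)) < r" using reals_Archimedean[OF r(1)] by blast
        moreover have "\<forall>r\<in>{inverse (real (Suc n))..s}. \<Phi> x (\<sigma> * r) \<in> \<Omega>" using * by blast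
        ultimately show ?thesis using r by simp
      qed
      then show "x \<in> {x. ereal s < exit_time \<Phi> \<Omega> \<sigma> x}"
        using less_exit_time_iff[OF s, of \<sigma> x] by simp
    qed
    also have "\<dots> \<in> sets borel"
      using stay by (intro sets.countable_INT') auto
    finally show ?thesis .
  qed
  consider "c < 0" | "c = 0" | s where "0 < s" "c = ereal s" | "c = \<infinity>"
    by (cases c) (auto, metis linorder_less_linear)
  then have "{x. c < exit_time \<Phi> \<Omega> \<sigma> x} \<in> sets borel"
  proof cases
    case 1
    then have "{x. c < exit_time \<Phi> \<Omega> \<sigma> x} = UNIV"
      using exit_time_nonneg[of \<sigma>] less_le_trans by blast
    then show ?thesis by simp
  next
    case 2
    have "{x. c < exit_time \<Phi> \<Omega> \<sigma> x} = (\<Union>n. {x. ereal (inverse (real (Suc n))) < exit_time \<Phi> \<Omega> \<sigma> x})"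
    proof (intro set_eqI iffI)
      fix x assume "x \<in> {x. c < exit_time \<Phi> \<Omega> \<sigma> x}"
      then obtain r where r: "0 < ereal r" "ereal r < exit_time \<Phi> \<Omega> \<sigma> x"
        using ereal_dense2[of 0 "exit_time \<Phi> \<Omega> \<sigma> x"] 2 by auto
      moreover obtain n where "inverse (real (Suc n)) < r" using reals_Archimedean r(1) by auto
      ultimately have "ereal (inverse (real (Suc n))) < exit_time \<Phi> \<Omega> \<sigma> x"
        by (intro less_trans[OF _ r(2)]) simp
      then show "x \<in> (\<Union>n. {x. ereal (inverse (real (Suc n))) < exit_time \<Phi> \<Omega> \<sigma> x})" by blast
    next
      fix x assume "x \<in> (\<Union>n. {x. ereal (inverse (real (Suc n))) < exit_time \<Phi> \<Omega> \<sigma> x})"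
      then obtain n where "ereal (inverse (real (Suc n))) < exit_time \<Phi> \<Omega> \<sigma> x" by blast
      moreover have "0 < ereal (inverse (real (Suc n)))" by simp
      ultimately show "x \<in> {x. c < exit_time \<Phi> \<Omega> \<sigma> x}" using 2 less_trans by blast
    qed
    also have "\<dots> \<in> sets borel"
      using gt by (intro sets.countable_UN) (auto simp del: of_nat_Suc)
    finally show ?thesis .
  qed (use gt in auto)
  then show "{x \<in> space borel. c < exit_time \<Phi> \<Omega> \<sigma> x} \<in> sets borel" by simp
qed

text \<open>
  A point outside \<open>\<Omega>\<close> whose recent past is in \<open>\<Omega>\<close> is a limit of points of \<open>\<Omega>\<close>, so it belongs
  to the frontier. Measurability can be read off this description, which mentions neither the frontier
  nor interior points.
\<close>

lemma outgoing_boundary_eq: "Gamma_plus \<Phi> \<Omega> = {y. y \<notin> \<Omega> \<and> 0 < tau_minus \<Phi> \<Omega> y}"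
proof (intro set_eqI iffI)
  fix y assume "y \<in> Gamma_plus \<Phi> \<Omega>"
  then obtain x where x: "x \<in> \<Omega>" "tau_plus \<Phi> \<Omega> x < \<infinity>" "y = \<Phi> x (real_of_ereal (tau_plus \<Phi> \<Omega> x))"
    by (auto simp: exit_boundary_def exits_at_def)
  obtain s where s: "tau_plus \<Phi> \<Omega> x = ereal s" "0 < s"
    using exit_time_pos[OF x(1), of 1] x(2) by (cases "tau_plus \<Phi> \<Omega> x") auto
  have y: "y = \<Phi> x s" using x(3) s by simp
  have "y \<notin> \<Omega>" using flow_exit_time[OF s] y by simp
  moreover have "ereal (s/2) < tau_minus \<Phi> \<Omega> y"
  proof (subst less_exit_time_iff)
    show "\<forall>r. 0 < r \<and> r \<le> s/2 \<longrightarrow> \<Phi> y (-1 * r) \<in> \<Omega>"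
    proof (intro allI impI)
      fix r assume r: "0 < r \<and> r \<le> s/2"
      have "ereal (s - r) < tau_plus \<Phi> \<Omega> x" using s r by simp
      then show "\<Phi> y (-1 * r) \<in> \<Omega>"
        using less_exit_time_iff[of "s - r" 1 x] r s by (auto simp: y)
    qed
  qed (use s in simp)
  then have "0 < tau_minus \<Phi> \<Omega> y"
    by (rule less_trans[rotated]) (use s(2) in simp)
  ultimately show "y \<in> {y. y \<notin> \<Omega> \<and> 0 < tau_minus \<Phi> \<Omega> y}" by simp
next
  fix y assume "y \<in> {y. y \<notin> \<Omega> \<and> 0 < tau_minus \<Phi> \<Omega> y}"
  then have y: "y \<notin> \<Omega>" "0 < tau_minus \<Phi> \<Omega> y" by auto
  obtain s where s: "0 < s" "ereal s < tau_minus \<Phi> \<Omega> y"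
    using ereal_dense2[OF y(2)] by auto
  have before: "\<Phi> y (- r) \<in> \<Omega>" if "0 < r" "r \<le> s" for r
    using less_exit_time_iff[OF s(1), of "-1" y] s(2) that by simp
  have "tau_plus \<Phi> \<Omega> (\<Phi> y (- s)) = ereal s"
  proof (rule exit_time_eqI[OF s(1)])
    fix r assume "0 < r" "r < s"
    then show "\<Phi> (\<Phi> y (- s)) (1 * r) \<in> \<Omega>" using before[of "s - r"] by simp
  qed (use y in simp)
  then have "exits_at \<Phi> \<Omega> 1 (\<Phi> y (- s)) y"
    using before[of s] s(1) by (simp add: exits_at_def)
  moreover have "y \<in> frontier \<Omega>"
  proof -
    have "(\<lambda>n. \<Phi> y (- (s * inverse (real (Suc n))))) \<longlonglongrightarrow> \<Phi> y (- (s * 0))"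
      by (intro isCont_tendsto_compose[of _ "\<Phi> y"] tendsto_intros LIMSEQ_inverse_real_of_nat)
         (use continuous_on_flow[of UNIV "\<lambda>_. y" "\<lambda>t. t"] in \<open>simp add: continuous_on_eq_continuous_at\<close>)
    moreover have "\<Phi> y (- (s * inverse (real (Suc n)))) \<in> \<Omega>" for n
      using s(1) by (intro before) (auto simp: field_simps)
    ultimately have "y \<in> closure \<Omega>"
      unfolding closure_sequential
      by (intro exI[of _ "\<lambda>n. \<Phi> y (- (s * inverse (real (Suc n))))"]) simp
    then show ?thesis using y(1) open_domain by (simp add: frontier_def interior_open)
  qed
  ultimately show "y \<in> Gamma_plus \<Phi> \<Omega>"
    by (auto simp: exit_boundary_def)
qed

lemma outgoing_boundary_borel [measurable]: "Gamma_plus \<Phi> \<Omega> \<in> sets borel"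
proof -
  have [measurable]: "\<Omega> \<in> sets borel" using open_domain by simp
  show ?thesis unfolding outgoing_boundary_eq by measurable
qed

text \<open>
  This lemma and the next one say that \<open>(y, s) \<mapsto> \<Phi> y (- s)\<close> is a bijection from the pairs with
  \<open>0 < s < tau_minus y\<close> onto the points of \<open>\<Omega>\<close> with finite forward exit time, with inverse
  \<open>x \<mapsto> (\<Phi> x (tau_plus x), tau_plus x)\<close>.
\<close>

lemma backwards_from_boundary:
  assumes "y \<in> Gamma_plus \<Phi> \<Omega>" "0 < s" "ereal s < tau_minus \<Phi> \<Omega> y"
  shows "\<Phi> y (- s) \<in> \<Omega>" "tau_plus \<Phi> \<Omega> (\<Phi> y (- s)) = ereal s"
proof -
  have before: "\<Phi> y (- r) \<in> \<Omega>" if "0 < r" "r \<le> s" for r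
    using less_exit_time_iff[OF assms(2), of "-1" y] assms(3) that by simp
  show "\<Phi> y (- s) \<in> \<Omega>" using before assms(2) by simp
  show "tau_plus \<Phi> \<Omega> (\<Phi> y (- s)) = ereal s"
  proof (rule exit_time_eqI[OF assms(2)])
    fix r assume "0 < r" "r < s"
    then show "\<Phi> (\<Phi> y (- s)) (1 * r) \<in> \<Omega>" using before[of "s - r"] by simp
  qed (use assms(1) in \<open>simp add: outgoing_boundary_eq\<close>)
qed

lemma forwards_to_boundary:
  assumes "x \<in> \<Omega>" "tau_plus \<Phi> \<Omega> x = ereal s"
  shows "0 < s" "\<Phi> x s \<in> Gamma_plus \<Phi> \<Omega>" "ereal s < tau_minus \<Phi> \<Omega> (\<Phi> x s)"
proof -
  show s: "0 < s" using exit_time_pos[OF assms(1), of 1] assms(2) by simp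
  have "\<Phi> x (s - r) \<in> \<Omega>" if "0 < r" "r \<le> s" for r
    using less_exit_time_iff[of "s - r" 1 x] assms that by (cases "r = s") auto
  then show l: "ereal s < tau_minus \<Phi> \<Omega> (\<Phi> x s)"
    unfolding less_exit_time_iff[OF s] by simp
  moreover have "0 < tau_minus \<Phi> \<Omega> (\<Phi> x s)"
    using s by (intro less_trans[OF _ l]) simp
  ultimately show "\<Phi> x s \<in> Gamma_plus \<Phi> \<Omega>"
    using flow_exit_time[OF assms(2) s] by (simp add: outgoing_boundary_eq)
qed

text \<open>
  Both sides say that the trajectory from \<open>\<Phi> x (- s)\<close> to \<open>x\<close> remains in \<open>\<Omega>\<close>.
\<close>

lemma less_exit_time_shift:
  assumes s: "0 < s"
  shows "x \<in> \<Omega> \<and> ereal s < tau_minus \<Phi> \<Omega> x \<longleftrightarrow>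
    \<Phi> x (- s) \<in> \<Omega> \<and> ereal s < tau_plus \<Phi> \<Omega> (\<Phi> x (- s))" (is "?L \<longleftrightarrow> ?R")
proof -
  have "?L \<longleftrightarrow> (\<forall>r\<in>{0..s}. \<Phi> x (- r) \<in> \<Omega>)"
    unfolding less_exit_time_iff[OF s] using s by (force simp: le_less)
  also have "\<dots> \<longleftrightarrow> (\<forall>r\<in>{0..s}. \<Phi> x (r - s) \<in> \<Omega>)"
  proof (intro iffI ballI)
    fix r assume "\<forall>r\<in>{0..s}. \<Phi> x (- r) \<in> \<Omega>" "r \<in> {0..s}"
    then show "\<Phi> x (r - s) \<in> \<Omega>" by (auto dest: bspec[of _ _ "s - r"])
  next
    fix r assume "\<forall>r\<in>{0..s}. \<Phi> x (r - s) \<in> \<Omega>" "r \<in> {0..s}"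
    then show "\<Phi> x (- r) \<in> \<Omega>" by (auto dest: bspec[of _ _ "s - r"])
  qed
  also have "\<dots> \<longleftrightarrow> ?R"
    unfolding less_exit_time_iff[OF s] using s by (force simp: le_less)
  finally show ?thesis .
qed

text \<open>
  The length of the trajectory that ends at \<open>y\<close> is the time needed to leave \<open>\<Omega>\<close> when starting from
  \<open>y\<close> backwards. In particular it does not depend on the interior point used in the definition, so
  the definite description is meaningful.
\<close>

lemma curve_length_outgoing:
  assumes y: "y \<in> Gamma_plus \<Phi> \<Omega>"
  shows "curve_length \<Phi> \<Omega> 1 y = tau_minus \<Phi> \<Omega> y"
proof -
  have *: "tau_minus \<Phi> \<Omega> x + tau_plus \<Phi> \<Omega> x = tau_minus \<Phi> \<Omega> y" if "exits_at \<Phi> \<Omega> 1 x y" for x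
  proof -
    have x: "x \<in> \<Omega>" "tau_plus \<Phi> \<Omega> x < \<infinity>" "y = \<Phi> x (real_of_ereal (tau_plus \<Phi> \<Omega> x))"
      using that by (auto simp: exits_at_def)
    obtain s where s: "tau_plus \<Phi> \<Omega> x = ereal s"
      using exit_time_pos[OF x(1), of 1] x(2) by (cases "tau_plus \<Phi> \<Omega> x") auto
    have y: "y = \<Phi> x s" using x(3) s by simp
    note f = forwards_to_boundary[OF x(1) s]
    have near: "\<Phi> y (- r) \<in> \<Omega>" if "0 < r" "r \<le> s" for r
      using less_exit_time_iff[OF f(1), of "-1" y] f(3) that y by simp
    consider u where "tau_minus \<Phi> \<Omega> x = ereal u" "0 < u" | "tau_minus \<Phi> \<Omega> x = \<infinity>"
      using exit_time_pos[OF x(1), of "-1"] by (cases "tau_minus \<Phi> \<Omega> x") auto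
    then show ?thesis
    proof cases
      case 1
      have "tau_minus \<Phi> \<Omega> y = ereal (s + u)"
      proof (rule exit_time_eqI)
        fix r assume r: "0 < r" "r < s + u"
        show "\<Phi> y (-1 * r) \<in> \<Omega>"
        proof (cases "r \<le> s")
          case False
          then show ?thesis
            using less_exit_time_iff[of "r - s" "-1" x] 1 r by (auto simp: y dest!: spec[of _ "r - s"])
        qed (use near r in simp)
      next
        show "\<Phi> y (- 1 * (s + u)) \<notin> \<Omega>"
          using flow_exit_time[OF 1] by (simp add: y)
      qed (use f 1 in simp)
      then show ?thesis using s 1 by (simp add: add.commute)
    next
      case 2
      have "tau_minus \<Phi> \<Omega> y = \<infinity>"
      proof (cases rule: exit_time_cases[of "-1" y])
        case (2 v)
        then have "s < v" using f(3) y by simp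
        then have "\<Phi> y (- v) \<notin> \<Omega>" using flow_exit_time[OF 2(2)] f(1) by simp
        moreover have "\<Phi> x (s - v) \<in> \<Omega>"
          using less_exit_time_iff[of "v - s" "-1" x] \<open>tau_minus \<Phi> \<Omega> x = \<infinity>\<close> \<open>s < v\<close>
          by (auto dest!: spec[of _ "v - s"])
        ultimately show ?thesis by (simp add: y)
      qed
      then show ?thesis using 2 s by simp
    qed
  qed
  obtain x where "exits_at \<Phi> \<Omega> 1 x y"
    using y by (auto simp: exit_boundary_def)
  with * show ?thesis
    unfolding curve_length_def by (intro the_equality) metis+
qed

lemma outgoing_boundary_exit_time_pos: "y \<in> Gamma_plus \<Phi> \<Omega> \<Longrightarrow> 0 < tau_minus \<Phi> \<Omega> y"
  by (simp add: outgoing_boundary_eq)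

end

lemma exit_boundary_reverse: "exit_boundary (\<lambda>x t. \<Phi> x (- t)) \<Omega> \<sigma> = exit_boundary \<Phi> \<Omega> (- \<sigma>)"
  by (simp add: exit_boundary_def exits_at_def exit_time_reverse)

lemma curve_length_reverse: "curve_length (\<lambda>x t. \<Phi> x (- t)) \<Omega> \<sigma> = curve_length \<Phi> \<Omega> (- \<sigma>)"
  by (simp add: curve_length_def exits_at_def exit_time_reverse add.commute fun_eq_iff)

section \<open>Completions of products\<close>

lemma completion_completion: "completion (completion M) = completion M"
proof (rule measure_eqI)
  show sets: "sets (completion (completion M)) = sets (completion M)"
  proof (intro set_eqI iffI)
    fix X assume "X \<in> sets (completion (completion M))"
    then obtain S N N' where "X = S \<union> N" "N \<subseteq> N'" "N' \<in> null_sets (completion M)" "S \<in> sets (completion M)"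
      by (rule sets_completionE)
    then show "X \<in> sets (completion M)"
      using null_sets_completion_subset[of N N' M] by (auto intro!: sets.Un dest: null_setsD2)
  qed simp
  fix X assume "X \<in> sets (completion (completion M))"
  then have "X \<in> sets (completion M)" using sets by simp
  then show "emeasure (completion (completion M)) X = emeasure (completion M) X"
    by (subst emeasure_completion) auto
qed

text \<open>
  The \<open>\<sigma>\<close>-algebra of \<open>completion M \<Otimes>\<^sub>M N\<close> lies between that of \<open>M \<Otimes>\<^sub>M N\<close> and that of its completion,
  because a null set times the whole space is a null set. As the two product measures agree on the
  smaller \<open>\<sigma>\<close>-algebra, they have the same completion.
\<close>

lemma completion_pair_completion:
  fixes M :: "'a measure" and N :: "'b measure"
  assumes N: "sigma_finite_measure N"
  shows "completion (completion M \<Otimes>\<^sub>M N) = completion (M \<Otimes>\<^sub>M N)"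
proof -
  interpret N: sigma_finite_measure N by (rule N)
  let ?A = "M \<Otimes>\<^sub>M N" and ?B = "completion M \<Otimes>\<^sub>M N"
  have sp: "space ?B = space ?A" by (simp add: space_pair_measure)
  have AB: "X \<in> sets ?B" if X: "X \<in> sets ?A" for X
  proof -
    have "fst \<in> ?B \<rightarrow>\<^sub>M M"
      by (rule measurable_compose[OF measurable_fst]) (auto simp: measurable_def sets.Int_space_eq2)
    then have "(\<lambda>z. (fst z, snd z)) \<in> ?B \<rightarrow>\<^sub>M ?A" by (intro measurable_Pair) auto
    from measurable_sets[OF this X] show ?thesis
      using sets.sets_into_space[OF X] by (simp add: sp Int_absorb2)
  qed
  have eq: "emeasure ?B X = emeasure ?A X" if X: "X \<in> sets ?A" for X
    using N.emeasure_pair_measure_alt[OF X] N.emeasure_pair_measure_alt[OF AB[OF X]]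
    by (simp add: nn_integral_completion)
  have BA: "X \<in> sets (completion ?A)" if X: "X \<in> sets ?B" for X
  proof -
    have "sets ?B \<subseteq> sets (completion ?A)"
    proof -
      have "a \<times> b \<in> sets (completion ?A)" if a: "a \<in> sets (completion M)" and b: "b \<in> sets N" for a b
      proof -
        obtain S Z Z' where a: "a = S \<union> Z" "Z \<subseteq> Z'" "Z' \<in> null_sets M" "S \<in> sets M"
          using a by (rule sets_completionE)
        show ?thesis
        proof (rule sets_completionI)
          show "a \<times> b = (S \<times> b) \<union> (Z \<times> b)" using a by auto
          show "Z \<times> b \<subseteq> Z' \<times> space N" using a sets.sets_into_space[OF b] by auto
          show "Z' \<times> space N \<in> null_sets ?A" using a(3) by auto
          show "S \<times> b \<in> sets ?A" using a b by auto
        qed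
      qed
      then have "sigma_sets (space (completion ?A)) {a \<times> b |a b. a \<in> sets (completion M) \<and> b \<in> sets N} \<subseteq> sets (completion ?A)"
        by (intro sets.sigma_sets_subset) auto
      then show ?thesis by (simp add: sets_pair_measure space_pair_measure)
    qed
    with X show ?thesis by auto
  qed
  have nAB: "X \<in> null_sets ?B" if "X \<in> null_sets ?A" for X
    using that AB eq by (auto simp: null_sets_def)
  have nBA: "X \<in> null_sets (completion ?A)" if X: "X \<in> null_sets ?B" for X
  proof -
    have "X \<in> sets (completion ?A)" using X BA by auto
    then obtain S Z Z' where Z: "X = S \<union> Z" "Z \<subseteq> Z'" "Z' \<in> null_sets ?A" "S \<in> sets ?A"
      by (rule sets_completionE)
    have "emeasure ?A S \<le> emeasure ?B X"
      unfolding eq[OF Z(4), symmetric] using Z X by (intro emeasure_mono) auto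
    then have "S \<in> null_sets ?A" using X Z(4) by (auto simp: null_sets_def)
    then have "S \<union> Z' \<in> null_sets ?A" using Z(3) by auto
    moreover have "X \<subseteq> S \<union> Z'" using Z by auto
    ultimately show ?thesis unfolding null_sets_completion_iff2 by blast
  qed
  show ?thesis
  proof (rule measure_eqI)
    show sets: "sets (completion ?B) = sets (completion ?A)"
    proof (intro set_eqI iffI)
      fix X assume "X \<in> sets (completion ?B)"
      then obtain S Z Z' where "X = S \<union> Z" "Z \<subseteq> Z'" "Z' \<in> null_sets ?B" "S \<in> sets ?B"
        by (rule sets_completionE)
      then show "X \<in> sets (completion ?A)"
        using null_sets_completion_subset[of Z Z' ?A] nBA BA by (auto intro!: sets.Un dest: null_setsD2)
    next
      fix X assume "X \<in> sets (completion ?A)"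
      then obtain S Z Z' where "X = S \<union> Z" "Z \<subseteq> Z'" "Z' \<in> null_sets ?A" "S \<in> sets ?A"
        by (rule sets_completionE)
      then show "X \<in> sets (completion ?B)"
        using AB nAB by (intro sets_completionI[of X S Z Z']) auto
    qed
    fix X assume "X \<in> sets (completion ?B)"
    then have X: "X \<in> sets (completion ?A)" using sets by simp
    define S Z where "S = main_part ?A X" and "Z = null_part ?A X"
    have S: "S \<in> sets ?A" and XS: "X = S \<union> Z" using X by (auto simp: S_def Z_def)
    obtain Z' where "Z' \<in> null_sets ?A" "Z \<subseteq> Z'" using null_part[OF X] by (auto simp: Z_def)
    then have "Z \<in> null_sets (completion ?B)" using nAB null_sets_completion_iff2 by blast
    then have "emeasure (completion ?B) X = emeasure (completion ?B) S"
      unfolding XS using AB[OF S] by (intro emeasure_Un_null_set) auto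
    also have "\<dots> = emeasure ?A S"
      using AB[OF S] eq[OF S] by simp
    also have "\<dots> = emeasure (completion ?A) X"
      using X by (simp add: S_def)
    finally show "emeasure (completion ?B) X = emeasure (completion ?A) X" .
  qed
qed

lemma
  fixes k k' :: "'a \<Rightarrow> real"
  assumes k': "k' \<in> borel_measurable M" and eq: "AE x in M. k x = k' x"
  shows integrable_completion_cong_AE: "integrable (completion M) k \<longleftrightarrow> integrable M k'"
    and integral_completion_cong_AE: "integral\<^sup>L (completion M) k = integral\<^sup>L M k'"
proof -
  have k'c: "k' \<in> borel_measurable (completion M)" using k' by (rule measurable_completion)
  have eq': "AE x in completion M. k x = k' x" using eq by (rule AE_completion)
  have kc: "k \<in> borel_measurable (completion M)"
  proof (rule measurableI)
    fix A :: "real set" assume "A \<in> sets borel"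
    then have *: "k' -` A \<inter> space (completion M) \<in> sets (completion M)" using k'c by (rule measurable_sets[rotated])
    have "AE x in completion M. x \<in> k' -` A \<inter> space (completion M) \<longleftrightarrow> x \<in> k -` A \<inter> space (completion M)"
      using eq' by eventually_elim auto
    from completion.in_sets_AE[OF this *] show "k -` A \<inter> space (completion M) \<in> sets (completion M)" by simp
  qed simp
  show "integrable (completion M) k \<longleftrightarrow> integrable M k'"
    using integrable_cong_AE[OF kc k'c eq'] integrable_completion[OF k'] by simp
  show "integral\<^sup>L (completion M) k = integral\<^sup>L M k'"
    using integral_cong_AE[OF kc k'c eq'] integral_completion[OF k'] by simp
qed

section \<open>Iterated integrals over intervals that depend on parameters\<close>

text \<open>
  The lemmas of this part reduce interval integrals with respect to completed measures to integrals of
  one integrable function \<open>G\<close> on a product of uncompleted measures, which Fubini's theorem evaluates.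
  Only almost everywhere equality with \<open>G\<close> is available, since the integrands will be of the
  form \<open>f \<circ> p\<close> with \<open>f\<close> merely measurable for a completion.
\<close>

lemma
  fixes k :: "real \<Rightarrow> real" and G :: "real \<Rightarrow> real"
  assumes b: "0 \<le> b" and G: "G \<in> borel_measurable borel"
    and eq: "AE s in lborel. G s = indicator (einterval 0 b) s * k s"
  shows interval_lebesgue_integrable_cong_AE:
      "interval_lebesgue_integrable lebesgue 0 b k \<longleftrightarrow> integrable lborel G"
    and interval_lebesgue_integral_cong_AE: "(LINT s=0..b|lebesgue. k s) = integral\<^sup>L lborel G"
proof -
  have G': "G \<in> borel_measurable lborel" using G by simp
  have eq': "AE s in lborel. indicator (einterval 0 b) s *\<^sub>R k s = G s" using eq by eventually_elim simp
  show "interval_lebesgue_integrable lebesgue 0 b k \<longleftrightarrow> integrable lborel G"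
    using integrable_completion_cong_AE[OF G' eq'] b
    by (simp add: interval_lebesgue_integrable_def set_integrable_def)
  show "(LINT s=0..b|lebesgue. k s) = integral\<^sup>L lborel G"
    using integral_completion_cong_AE[OF G' eq'] b
    by (simp add: interval_lebesgue_integral_def set_lebesgue_integral_def)
qed

lemma
  fixes P :: "'a measure" and b :: "'a \<Rightarrow> ereal" and g :: "'a \<Rightarrow> real \<Rightarrow> real"
    and G :: "'a \<times> real \<Rightarrow> real"
  assumes P: "sigma_finite_measure P" and b: "\<And>y. y \<in> space P \<Longrightarrow> 0 \<le> b y"
    and G: "integrable (P \<Otimes>\<^sub>M lborel) G"
    and eq: "AE y in P. AE s in lborel. G (y, s) = indicator (einterval 0 (b y)) s * g y s"
  shows AE_interval_integrable: "AE y in P. interval_lebesgue_integrable lebesgue 0 (b y) (g y)"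
    and integrable_interval_integral: "integrable (completion P) (\<lambda>y. LINT s=0..b y|lebesgue. g y s)"
    and integral_interval_integral:
      "(LINT y|completion P. (LINT s=0..b y|lebesgue. g y s)) = integral\<^sup>L (P \<Otimes>\<^sub>M lborel) G"
proof -
  interpret P: sigma_finite_measure P by (rule P)
  interpret PL: pair_sigma_finite P lborel ..
  have [measurable]: "G \<in> borel_measurable (P \<Otimes>\<^sub>M lborel)" using G by simp
  have Gs: "(\<lambda>s. G (y, s)) \<in> borel_measurable borel" if "y \<in> space P" for y
    using measurable_compose_Pair1[OF that, of G lborel borel] by simp
  show "AE y in P. interval_lebesgue_integrable lebesgue 0 (b y) (g y)"
    using PL.AE_integrable_fst'[OF G] eq AE_space
    by eventually_elim (simp add: interval_lebesgue_integrable_cong_AE[OF b Gs])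
  have J: "AE y in P. (LINT s=0..b y|lebesgue. g y s) = (\<integral>s. G (y, s) \<partial>lborel)"
    using eq AE_space by eventually_elim (simp add: interval_lebesgue_integral_cong_AE[OF b Gs])
  have m: "(\<lambda>y. \<integral>s. G (y, s) \<partial>lborel) \<in> borel_measurable P" by measurable
  show "integrable (completion P) (\<lambda>y. LINT s=0..b y|lebesgue. g y s)"
    using integrable_completion_cong_AE[OF m J] PL.integrable_fst'[OF G] by simp
  show "(LINT y|completion P. (LINT s=0..b y|lebesgue. g y s)) = integral\<^sup>L (P \<Otimes>\<^sub>M lborel) G"
    using integral_completion_cong_AE[OF m J] PL.integral_fst'[OF G] by simp
qed

lemma
  fixes P :: "'a::euclidean_space measure" and b :: "real \<Rightarrow> 'a \<Rightarrow> ereal"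
    and g :: "real \<Rightarrow> 'a \<Rightarrow> real \<Rightarrow> real" and G :: "real \<times> 'a \<times> real \<Rightarrow> real"
  assumes P: "sigma_finite_measure P" and T: "0 < T"
    and b: "\<And>t y. t \<in> {0<..<T} \<Longrightarrow> y \<in> space P \<Longrightarrow> 0 \<le> b t y"
    and G: "integrable (lborel \<Otimes>\<^sub>M P \<Otimes>\<^sub>M lborel) G"
    and eq: "AE t in lborel. AE y in P. AE s in lborel.
      G (t, y, s) = indicator {0<..<T} t * (indicator (einterval 0 (b t y)) s * g t y s)"
  shows boundary_integral_existsI: "boundary_integral_exists T P b g"
    and boundary_integral_eq:
      "(LINT t=0..ereal T|lebesgue. (LINT y|completion P. (LINT s=0..b t y|lebesgue. g t y s))) =
        integral\<^sup>L (lborel \<Otimes>\<^sub>M P \<Otimes>\<^sub>M lborel) G"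
proof -
  interpret P: sigma_finite_measure P by (rule P)
  interpret PL: pair_sigma_finite P lborel ..
  interpret LPL: pair_sigma_finite lborel "P \<Otimes>\<^sub>M lborel" ..
  have [measurable]: "G \<in> borel_measurable (lborel \<Otimes>\<^sub>M P \<Otimes>\<^sub>M lborel)" using G by simp
  have slice: "AE t in lborel. t \<in> {0<..<T} \<longrightarrow> integrable (P \<Otimes>\<^sub>M lborel) (\<lambda>z. G (t, z)) \<and>
      (AE y in P. AE s in lborel. G (t, y, s) = indicator (einterval 0 (b t y)) s * g t y s)"
    using LPL.AE_integrable_fst'[OF G] eq by eventually_elim auto
  have ex: "AE t in lborel. t \<in> {0<..<T} \<longrightarrow>
        (AE y in P. interval_lebesgue_integrable lebesgue 0 (b t y) (g t y)) \<and>
        integrable (completion P) (\<lambda>y. LINT s=0..b t y|lebesgue. g t y s)"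
    using slice
  proof eventually_elim
    fix t assume 1: "t \<in> {0<..<T} \<longrightarrow> integrable (P \<Otimes>\<^sub>M lborel) (\<lambda>z. G (t, z)) \<and>
      (AE y in P. AE s in lborel. G (t, y, s) = indicator (einterval 0 (b t y)) s * g t y s)"
    show "t \<in> {0<..<T} \<longrightarrow>
        (AE y in P. interval_lebesgue_integrable lebesgue 0 (b t y) (g t y)) \<and>
        integrable (completion P) (\<lambda>y. LINT s=0..b t y|lebesgue. g t y s)"
    proof (intro impI conjI)
      assume t: "t \<in> {0<..<T}"
      note G = 1[THEN mp, OF t, THEN conjunct1] 1[THEN mp, OF t, THEN conjunct2]
      show "AE y in P. interval_lebesgue_integrable lebesgue 0 (b t y) (g t y)"
        by (rule AE_interval_integrable[OF P b[OF t] G])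
      show "integrable (completion P) (\<lambda>y. LINT s=0..b t y|lebesgue. g t y s)"
        by (rule integrable_interval_integral[OF P b[OF t] G])
    qed
  qed
  have J: "AE t in lborel. (\<integral>z. G (t, z) \<partial>(P \<Otimes>\<^sub>M lborel)) =
      indicator (einterval 0 (ereal T)) t * (LINT y|completion P. (LINT s=0..b t y|lebesgue. g t y s))"
    using slice eq
  proof eventually_elim
    fix t assume 1: "t \<in> {0<..<T} \<longrightarrow> integrable (P \<Otimes>\<^sub>M lborel) (\<lambda>z. G (t, z)) \<and>
      (AE y in P. AE s in lborel. G (t, y, s) = indicator (einterval 0 (b t y)) s * g t y s)"
      and 2: "AE y in P. AE s in lborel.
        G (t, y, s) = indicator {0<..<T} t * (indicator (einterval 0 (b t y)) s * g t y s)"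
    show "(\<integral>z. G (t, z) \<partial>(P \<Otimes>\<^sub>M lborel)) =
      indicator (einterval 0 (ereal T)) t * (LINT y|completion P. (LINT s=0..b t y|lebesgue. g t y s))"
    proof (cases "t \<in> {0<..<T}")
      case True
      note G = 1[THEN mp, OF True, THEN conjunct1] 1[THEN mp, OF True, THEN conjunct2]
      show ?thesis
        using integral_interval_integral[OF P b[OF True] G] True
        by (simp add: einterval_iff)
    next
      case False
      have [measurable]: "(\<lambda>z. G (t, z)) \<in> borel_measurable (P \<Otimes>\<^sub>M lborel)" by measurable
      have "AE z in P \<Otimes>\<^sub>M lborel. G (t, z) = 0"
      proof (rule PL.AE_pair_measure)
        show "{x \<in> space (P \<Otimes>\<^sub>M lborel). G (t, x) = 0} \<in> sets (P \<Otimes>\<^sub>M lborel)" by measurable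
        show "AE x in P. AE y in lborel. G (t, x, y) = 0" using 2 False by simp
      qed
      then have "(\<integral>z. G (t, z) \<partial>(P \<Otimes>\<^sub>M lborel)) = 0" by (rule integral_eq_zero_AE)
      then show ?thesis using False by (auto simp: einterval_iff indicator_def)
    qed
  qed
  have m: "(\<lambda>t. \<integral>z. G (t, z) \<partial>(P \<Otimes>\<^sub>M lborel)) \<in> borel_measurable borel" by measurable
  have T': "0 \<le> ereal T" using T by simp
  show "boundary_integral_exists T P b g"
    unfolding boundary_integral_exists_def
    using AE_completion[OF ex] interval_lebesgue_integrable_cong_AE[OF T' m J] LPL.integrable_fst'[OF G]
    by simp
  show "(LINT t=0..ereal T|lebesgue. (LINT y|completion P. (LINT s=0..b t y|lebesgue. g t y s))) =
        integral\<^sup>L (lborel \<Otimes>\<^sub>M P \<Otimes>\<^sub>M lborel) G"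
    using interval_lebesgue_integral_cong_AE[OF T' m J] LPL.integral_fst'[OF G] by simp
qed

lemma
  fixes \<mu> :: "'a::euclidean_space measure" and b :: "'a \<Rightarrow> ereal" and g :: "'a \<Rightarrow> real \<Rightarrow> real"
    and G :: "'a \<times> real \<Rightarrow> real"
  assumes \<mu>: "sigma_finite_measure \<mu>" and b: "\<And>x. x \<in> \<Omega> \<Longrightarrow> 0 \<le> b x" and \<Omega>: "\<Omega> \<in> sets \<mu>"
    and G: "integrable (\<mu> \<Otimes>\<^sub>M lborel) G"
    and eq: "AE x in \<mu>. AE s in lborel. G (x, s) = indicator \<Omega> x * (indicator (einterval 0 (b x)) s * g x s)"
  shows interior_integral_existsI: "interior_integral_exists \<Omega> \<mu> b g"
    and interior_integral_eq:
      "(LINT x:\<Omega>|completion \<mu>. (LINT s=0..b x|lebesgue. g x s)) = integral\<^sup>L (\<mu> \<Otimes>\<^sub>M lborel) G"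
proof -
  \<comment> \<open>Extending by an empty interval off \<open>\<Omega>\<close> reduces the claim to the case of the whole space.\<close>
  define b' where "b' x = (if x \<in> \<Omega> then b x else 0)" for x
  define g' where "g' x s = indicator \<Omega> x * g x s" for x s
  have b': "0 \<le> b' x" for x using b by (simp add: b'_def)
  have eq': "AE x in \<mu>. AE s in lborel. G (x, s) = indicator (einterval 0 (b' x)) s * g' x s"
    using eq by eventually_elim (auto simp: b'_def g'_def einterval_iff indicator_def)
  have i: "(LINT s=0..b' x|lebesgue. g' x s) = indicator \<Omega> x *\<^sub>R (LINT s=0..b x|lebesgue. g x s)" for x
    by (auto simp: b'_def g'_def interval_lebesgue_integral_def set_lebesgue_integral_def indicator_def)
  show "interior_integral_exists \<Omega> \<mu> b g"
    unfolding interior_integral_exists_def set_integrable_def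
    using AE_interval_integrable[OF \<mu> b' G eq'] integrable_interval_integral[OF \<mu> b' G eq']
    unfolding i by (auto simp: b'_def g'_def)
  show "(LINT x:\<Omega>|completion \<mu>. (LINT s=0..b x|lebesgue. g x s)) = integral\<^sup>L (\<mu> \<Otimes>\<^sub>M lborel) G"
    using integral_interval_integral[OF \<mu> b' G eq'] unfolding i by (simp add: set_lebesgue_integral_def)
qed

section \<open>From nonnegative Borel functions to integrable functions\<close>

text \<open>
  The hypothesis \<open>formula\<close> is a change of variables for nonnegative measurable functions, which says that
  the measure on \<open>D\<close> is the sum of the images of two restricted product measures under \<open>p\<close> and \<open>q\<close>.
  A function \<open>f\<close> on the completion differs from a Borel function \<open>f'\<close> only on a null set. Applied to the
  indicator of that null set, the formula shows that \<open>f \<circ> p\<close> and \<open>f \<circ> q\<close> differ from \<open>f' \<circ> p\<close> and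
  \<open>f' \<circ> q\<close> only on null sets, and applied to \<open>\<bar>f'\<bar>\<close> it gives integrability.
\<close>

lemma
  fixes \<mu> P :: "'a::euclidean_space measure" and b :: "real \<Rightarrow> 'a \<Rightarrow> ereal" and c :: "'a \<Rightarrow> ereal"
    and p :: "real \<times> 'a \<times> real \<Rightarrow> 'a \<times> real" and q :: "'a \<times> real \<Rightarrow> 'a \<times> real" and f :: "'a \<times> real \<Rightarrow> real"
    and \<Omega> :: "'a set" and T :: real
  defines "D \<equiv> \<Omega> \<times> {0<..<T}"
    and "B \<equiv> {(t, y, s). t \<in> {0<..<T} \<and> y \<in> space P \<and> s \<in> einterval 0 (b t y)}"
    and "C \<equiv> {(x, s). x \<in> \<Omega> \<and> s \<in> einterval 0 (c x)}"
  assumes \<mu>: "sigma_finite_measure \<mu>" and P: "sigma_finite_measure P" and T: "0 < T" and \<Omega>: "\<Omega> \<in> sets \<mu>"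
    and b: "\<And>t y. t \<in> {0<..<T} \<Longrightarrow> y \<in> space P \<Longrightarrow> 0 \<le> b t y" and c: "\<And>x. x \<in> \<Omega> \<Longrightarrow> 0 \<le> c x"
    and p: "p \<in> lborel \<Otimes>\<^sub>M P \<Otimes>\<^sub>M lborel \<rightarrow>\<^sub>M \<mu> \<Otimes>\<^sub>M lborel" and q: "q \<in> \<mu> \<Otimes>\<^sub>M lborel \<rightarrow>\<^sub>M \<mu> \<Otimes>\<^sub>M lborel"
    and B: "B \<in> sets (lborel \<Otimes>\<^sub>M P \<Otimes>\<^sub>M lborel)" and C: "C \<in> sets (\<mu> \<Otimes>\<^sub>M lborel)"
    and pB: "p ` B \<subseteq> D" and qC: "q ` C \<subseteq> D"
    and formula: "\<And>F :: 'a \<times> real \<Rightarrow> ennreal. F \<in> borel_measurable (\<mu> \<Otimes>\<^sub>M lborel) \<Longrightarrow>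
      (\<integral>\<^sup>+z. F z * indicator D z \<partial>(\<mu> \<Otimes>\<^sub>M lborel)) =
      (\<integral>\<^sup>+z. F (p z) * indicator B z \<partial>(lborel \<Otimes>\<^sub>M P \<Otimes>\<^sub>M lborel)) +
      (\<integral>\<^sup>+z. F (q z) * indicator C z \<partial>(\<mu> \<Otimes>\<^sub>M lborel))"
    and f: "integrable (mu_T \<mu> \<Omega> T) f"
  shows boundary_integral_exists_transfer: "boundary_integral_exists T P b (\<lambda>t y s. f (p (t, y, s)))"
    and interior_integral_exists_transfer: "interior_integral_exists \<Omega> \<mu> c (\<lambda>x s. f (q (x, s)))"
    and integral_transfer: "(LINT z|mu_T \<mu> \<Omega> T. f z) =
      (LINT t=0..ereal T|lebesgue. (LINT y|completion P. (LINT s=0..b t y|lebesgue. f (p (t, y, s))))) +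
      (LINT x:\<Omega>|completion \<mu>. (LINT s=0..c x|lebesgue. f (q (x, s))))"
proof -
  interpret mu: sigma_finite_measure \<mu> by (rule \<mu>)
  interpret P: sigma_finite_measure P by (rule P)
  interpret MuL: pair_sigma_finite \<mu> lborel ..
  interpret PL: pair_sigma_finite P lborel ..
  interpret LPL: pair_sigma_finite lborel "P \<Otimes>\<^sub>M lborel" ..
  let ?Z = "\<mu> \<Otimes>\<^sub>M lborel" and ?W = "lborel \<Otimes>\<^sub>M P \<Otimes>\<^sub>M lborel"
  note [measurable] = p q B C
  have D [measurable]: "D \<in> sets ?Z" unfolding D_def using \<Omega> by auto
  have mu_T: "mu_T \<mu> \<Omega> T = restrict_space (completion ?Z) D" by (simp add: mu_T_def D_def)
  have "integrable (completion ?Z) (\<lambda>z. indicator D z * f z)"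
    using f D unfolding mu_T by (subst (asm) integrable_restrict_space) auto
  then obtain h where h [measurable]: "h \<in> borel_measurable ?Z" and fh: "AE z in ?Z. indicator D z * f z = h z"
    using completion_ex_borel_measurable_real[OF borel_measurable_integrable] by blast
  define f' where "f' z = indicator D z * h z" for z
  have f' [measurable]: "f' \<in> borel_measurable ?Z" unfolding f'_def by measurable
  have ff': "AE z in ?Z. indicator D z * f z = f' z"
    using fh by eventually_elim (auto simp: f'_def indicator_def)
  have int_f': "integrable ?Z f'"
    using integrable_completion_cong_AE[OF f' ff'] \<open>integrable (completion ?Z) _\<close> by simp
  have eq_f': "(LINT z|mu_T \<mu> \<Omega> T. f z) = integral\<^sup>L ?Z f'"
    using integral_completion_cong_AE[OF f' ff'] D unfolding mu_T by (subst integral_restrict_space) auto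
  obtain N where N: "N \<in> null_sets ?Z" "{z \<in> space ?Z. indicator D z * f z \<noteq> f' z} \<subseteq> N"
    using ff' by (auto elim!: AE_E simp: null_sets_def)
  have [measurable]: "N \<in> sets ?Z" using N by auto
  have "(\<integral>\<^sup>+z. indicator N z * indicator D z \<partial>?Z) = 0"
    using AE_not_in[OF N(1)] by (subst nn_integral_0_iff_AE) auto
  then have null: "(\<integral>\<^sup>+z. indicator N (p z) * indicator B z \<partial>?W) = 0"
      "(\<integral>\<^sup>+z. indicator N (q z) * indicator C z \<partial>?Z) = 0"
    by (subst (asm) formula; simp)+
  have p_eq: "AE z in ?W. z \<in> B \<longrightarrow> f (p z) = f' (p z)"
  proof -
    have "AE z in ?W. (indicator N (p z) * indicator B z :: ennreal) = 0"
      using null(1) by (subst (asm) nn_integral_0_iff_AE) auto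
    then show ?thesis using AE_space
    proof eventually_elim
      fix z assume z: "(indicator N (p z) * indicator B z :: ennreal) = 0" "z \<in> space ?W"
      show "z \<in> B \<longrightarrow> f (p z) = f' (p z)"
      proof
        assume "z \<in> B"
        then have "p z \<notin> N" "p z \<in> D" using z pB by (auto simp: indicator_def split: if_splits)
        moreover have "p z \<in> space ?Z" using measurable_space[OF p z(2)] .
        ultimately show "f (p z) = f' (p z)" using N(2) by auto
      qed
    qed
  qed
  have q_eq: "AE z in ?Z. z \<in> C \<longrightarrow> f (q z) = f' (q z)"
  proof -
    have "AE z in ?Z. (indicator N (q z) * indicator C z :: ennreal) = 0"
      using null(2) by (subst (asm) nn_integral_0_iff_AE) auto
    then show ?thesis using AE_space
    proof eventually_elim
      fix z assume z: "(indicator N (q z) * indicator C z :: ennreal) = 0" "z \<in> space ?Z"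
      show "z \<in> C \<longrightarrow> f (q z) = f' (q z)"
      proof
        assume "z \<in> C"
        then have "q z \<notin> N" "q z \<in> D" using z qC by (auto simp: indicator_def split: if_splits)
        moreover have "q z \<in> space ?Z" using measurable_space[OF q z(2)] .
        ultimately show "f (q z) = f' (q z)" using N(2) by auto
      qed
    qed
  qed
  define G where "G z = f' (p z) * indicator B z" for z
  define H where "H z = f' (q z) * indicator C z" for z
  have G_m [measurable]: "G \<in> borel_measurable ?W" unfolding G_def by measurable
  have H_m [measurable]: "H \<in> borel_measurable ?Z" unfolding H_def by measurable
  \<comment> \<open>The cases \<open>k = norm\<close>, \<open>k = id\<close> and \<open>k = uminus\<close> give integrability and the positive and negative parts.\<close>
  have split: "(\<integral>\<^sup>+z. ennreal (k (f' z)) \<partial>?Z) = (\<integral>\<^sup>+z. ennreal (k (G z)) \<partial>?W) + (\<integral>\<^sup>+z. ennreal (k (H z)) \<partial>?Z)"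
    if [measurable]: "k \<in> borel_measurable borel" and k: "k 0 = 0" for k :: "real \<Rightarrow> real"
  proof -
    have "(\<integral>\<^sup>+z. ennreal (k (f' z)) \<partial>?Z) = (\<integral>\<^sup>+z. ennreal (k (f' z)) * indicator D z \<partial>?Z)"
      by (intro nn_integral_cong) (auto simp: f'_def indicator_def k)
    also have "\<dots> = (\<integral>\<^sup>+z. ennreal (k (f' (p z))) * indicator B z \<partial>?W) + (\<integral>\<^sup>+z. ennreal (k (f' (q z))) * indicator C z \<partial>?Z)"
      by (rule formula) measurable
    also have "(\<integral>\<^sup>+z. ennreal (k (f' (p z))) * indicator B z \<partial>?W) = (\<integral>\<^sup>+z. ennreal (k (G z)) \<partial>?W)"
      by (intro nn_integral_cong) (auto simp: G_def indicator_def k)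
    also have "(\<integral>\<^sup>+z. ennreal (k (f' (q z))) * indicator C z \<partial>?Z) = (\<integral>\<^sup>+z. ennreal (k (H z)) \<partial>?Z)"
      by (intro nn_integral_cong) (auto simp: H_def indicator_def k)
    finally show ?thesis .
  qed
  have "(\<integral>\<^sup>+z. ennreal (norm (G z)) \<partial>?W) + (\<integral>\<^sup>+z. ennreal (norm (H z)) \<partial>?Z) < \<infinity>"
    using split[of norm] int_f' by (simp add: integrable_iff_bounded)
  then have G: "integrable ?W G" and H: "integrable ?Z H"
    by (auto intro!: integrableI_bounded simp: less_top[symmetric])
  have "integral\<^sup>L ?Z f' = enn2real (\<integral>\<^sup>+z. ennreal (f' z) \<partial>?Z) - enn2real (\<integral>\<^sup>+z. ennreal (- f' z) \<partial>?Z)"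
    by (rule real_lebesgue_integral_def[OF int_f'])
  also have "\<dots> = integral\<^sup>L ?W G + integral\<^sup>L ?Z H"
    unfolding split[of "\<lambda>x. x", simplified] split[of "\<lambda>x. - x", simplified]
      real_lebesgue_integral_def[OF G] real_lebesgue_integral_def[OF H]
    using integrableD[OF G] integrableD[OF H] by (simp add: enn2real_plus less_top)
  finally have sum: "integral\<^sup>L ?Z f' = integral\<^sup>L ?W G + integral\<^sup>L ?Z H" .
  have "AE z in ?W. G z = indicator {0<..<T} (fst z) *
      (indicator (einterval 0 (b (fst z) (fst (snd z)))) (snd (snd z)) * f (p z))"
    using p_eq AE_space by eventually_elim (auto simp: G_def B_def indicator_def space_pair_measure)
  from LPL.AE_pair[OF this]
  have "AE t in lborel. AE z in P \<Otimes>\<^sub>M lborel. G (t, z) = indicator {0<..<T} t *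
      (indicator (einterval 0 (b t (fst z))) (snd z) * f (p (t, z)))"
    by simp
  then have G_eq: "AE t in lborel. AE y in P. AE s in lborel. G (t, y, s) = indicator {0<..<T} t *
      (indicator (einterval 0 (b t y)) s * f (p (t, y, s)))"
  proof eventually_elim
    fix t assume "AE z in P \<Otimes>\<^sub>M lborel. G (t, z) = indicator {0<..<T} t *
      (indicator (einterval 0 (b t (fst z))) (snd z) * f (p (t, z)))"
    from PL.AE_pair[OF this] show "AE y in P. AE s in lborel. G (t, y, s) = indicator {0<..<T} t *
      (indicator (einterval 0 (b t y)) s * f (p (t, y, s)))" by simp
  qed
  have "AE z in ?Z. H z = indicator \<Omega> (fst z) * (indicator (einterval 0 (c (fst z))) (snd z) * f (q z))"
    using q_eq AE_space by eventually_elim (auto simp: H_def C_def indicator_def space_pair_measure)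
  from MuL.AE_pair[OF this]
  have H_eq: "AE x in \<mu>. AE s in lborel. H (x, s) = indicator \<Omega> x * (indicator (einterval 0 (c x)) s * f (q (x, s)))"
    by simp
  show "boundary_integral_exists T P b (\<lambda>t y s. f (p (t, y, s)))"
    by (rule boundary_integral_existsI[OF P T b G G_eq])
  show "interior_integral_exists \<Omega> \<mu> c (\<lambda>x s. f (q (x, s)))"
    by (rule interior_integral_existsI[OF \<mu> c \<Omega> H H_eq])
  show "(LINT z|mu_T \<mu> \<Omega> T. f z) =
      (LINT t=0..ereal T|lebesgue. (LINT y|completion P. (LINT s=0..b t y|lebesgue. f (p (t, y, s))))) +
      (LINT x:\<Omega>|completion \<mu>. (LINT s=0..c x|lebesgue. f (q (x, s))))"
    using boundary_integral_eq[OF P T b G G_eq] interior_integral_eq[OF \<mu> c \<Omega> H H_eq]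
    by (simp add: eq_f' sum)
qed

section \<open>Tools from measure theory\<close>

lemma sigma_finite_measureI_positive_integrable:
  fixes k :: "'a \<Rightarrow> ennreal"
  assumes k [measurable]: "k \<in> borel_measurable M" and pos: "\<And>x. x \<in> space M \<Longrightarrow> 0 < k x"
    and fin: "integral\<^sup>N M k < \<infinity>"
  shows "sigma_finite_measure M"
proof
  define A where "A n = {x \<in> space M. 1 \<le> of_nat n * k x}" for n :: nat
  have "emeasure M (A n) \<noteq> \<infinity>" for n
  proof -
    have "emeasure M (A n) \<le> of_nat n * (\<integral>\<^sup>+x. k x * indicator (space M) x \<partial>M)"
      unfolding A_def by (rule nn_integral_Markov_inequality) auto
    also have "(\<integral>\<^sup>+x. k x * indicator (space M) x \<partial>M) = integral\<^sup>N M k"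
      by (intro nn_integral_cong) auto
    also have "of_nat n * integral\<^sup>N M k < \<infinity>"
      using fin by (simp add: ennreal_mult_less_top of_nat_less_top)
    finally show ?thesis by (simp add: less_top)
  qed
  moreover have "(\<Union>n. A n) = space M"
  proof (intro set_eqI iffI)
    fix x assume x: "x \<in> space M"
    have "inverse (k x) < top" using pos[OF x] by (simp add: less_top[symmetric])
    then obtain n where n: "inverse (k x) < of_nat n" by (metis ennreal_Ex_less_of_nat)
    have "1 \<le> of_nat n * k x"
    proof (cases "k x = top")
      case True
      then show ?thesis using n by (cases n) (auto simp: ennreal_mult_top)
    next
      case False
      then have "1 = inverse (k x) * k x"
        using pos[OF x] ennreal_divide_self[of "k x"]
        by (simp add: less_top divide_ennreal_def mult.commute)
      also have "\<dots> \<le> of_nat n * k x" using n by (intro mult_right_mono) auto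
      finally show ?thesis .
    qed
    then show "x \<in> (\<Union>n. A n)" using x by (auto simp: A_def)
  qed (auto simp: A_def)
  moreover have "range A \<subseteq> sets M" unfolding A_def by auto
  ultimately show "\<exists>A. countable A \<and> A \<subseteq> sets M \<and> \<Union>A = space M \<and> (\<forall>a\<in>A. emeasure M a \<noteq> \<infinity>)"
    by (intro exI[of _ "range A"]) auto
qed

lemma AE_lborel_interval_witness:
  fixes a b :: real
  assumes ae: "AE s in lborel. s \<in> {a<..<b} \<longrightarrow> Q s" and ab: "a < b"
  shows "\<exists>s\<in>{a<..<b}. Q s"
proof (rule ccontr)
  assume "\<not> (\<exists>s\<in>{a<..<b}. Q s)"
  then have "AE s in lborel. s \<notin> {a<..<b}"
    using ae by (auto elim!: eventually_mono)
  then have "emeasure lborel {a<..<b} = 0"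
    by (subst (asm) AE_iff_measurable[of "{a<..<b}"]) auto
  then show False using ab by simp
qed

lemma nn_integral_einterval_pos:
  assumes l: "0 < l" and [measurable]: "u \<in> borel_measurable borel"
    and pos: "\<And>s. s \<in> einterval 0 l \<Longrightarrow> 0 < u s"
  shows "0 < (\<integral>\<^sup>+s. indicator (einterval 0 l) s * (u s :: ennreal) \<partial>lborel)"
proof (rule ccontr)
  assume "\<not> 0 < (\<integral>\<^sup>+s. indicator (einterval 0 l) s * u s \<partial>lborel)"
  then have ae: "AE s in lborel. indicator (einterval 0 l) s * u s = 0"
    by (subst (asm) not_gr_zero, subst (asm) nn_integral_0_iff_AE) auto
  obtain r where r: "0 < r" "ereal r < l" using ereal_dense2[OF l] by auto
  from ae have "AE s in lborel. s \<in> {0<..<r} \<longrightarrow> False"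
  proof eventually_elim
    fix s assume s: "indicator (einterval 0 l) s * u s = 0"
    show "s \<in> {0<..<r} \<longrightarrow> False"
    proof
      assume "s \<in> {0<..<r}"
      then have "s \<in> einterval 0 l" using r(2) by (auto simp: einterval_iff) (meson less_ereal.simps(1) less_trans)
      then show False using s pos[of s] by simp
    qed
  qed
  then show False using AE_lborel_interval_witness[of 0 r "\<lambda>_. False"] r(1) by auto
qed

lemma density_inj:
  assumes sets: "sets P = sets Q"
    and P [measurable]: "k \<in> borel_measurable P"
    and k: "\<And>y. y \<in> space P \<Longrightarrow> 0 < k y \<and> k y < \<infinity>"
    and eq: "\<And>A. A \<in> sets P \<Longrightarrow> (\<integral>\<^sup>+y. indicator A y * k y \<partial>P) = (\<integral>\<^sup>+y. indicator A y * k y \<partial>Q)"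
  shows "P = Q"
proof -
  have sp: "space P = space Q" using sets by (rule sets_eq_imp_space_eq)
  have Q [measurable]: "k \<in> borel_measurable Q" using P measurable_cong_sets[OF sets refl] by blast
  have inv: "k y * inverse (k y) = 1" if "y \<in> space P" for y
    using k[OF that] ennreal_divide_self[of "k y"] by (auto simp: divide_ennreal_def less_top)
  have d: "density P k = density Q k"
  proof (rule measure_eqI)
    fix A assume "A \<in> sets (density P k)"
    then have A: "A \<in> sets P" "A \<in> sets Q" using sets by auto
    show "emeasure (density P k) A = emeasure (density Q k) A"
      using eq[OF A(1)] A by (simp add: emeasure_density mult.commute)
  qed (simp add: sets)
  have id: "density (density M k) (\<lambda>y. inverse (k y)) = M"
    if [measurable]: "k \<in> borel_measurable M" and "space M = space P" for M
  proof -
    have "density (density M k) (\<lambda>y. inverse (k y)) = density M (\<lambda>y. k y * inverse (k y))"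
      by (rule density_density_eq) measurable
    also have "\<dots> = density M (\<lambda>_. 1)"
      using inv that by (intro density_cong) auto
    finally show ?thesis by (simp add: density_1)
  qed
  have "P = density (density P k) (\<lambda>y. inverse (k y))" by (rule id[OF P refl, symmetric])
  also have "\<dots> = density (density Q k) (\<lambda>y. inverse (k y))" by (simp only: d)
  also have "\<dots> = Q" by (rule id[OF Q sp[symmetric]])
  finally show ?thesis .
qed

section \<open>The measure on the outgoing boundary\<close>

locale invariant_flow = flow_domain \<Phi> \<Omega> + sigma_finite_measure \<mu>
  for \<Phi> :: "'a::euclidean_space \<Rightarrow> real \<Rightarrow> 'a" and \<Omega> :: "'a set" and \<mu> :: "'a measure" +
  assumes sets_mu [measurable_cong]: "sets \<mu> = sets borel"
    and invariant: "distr \<mu> borel (\<lambda>x. \<Phi> x t) = \<mu>"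
begin

lemma reverse_invariant: "invariant_flow (\<lambda>x t. \<Phi> x (- t)) \<Omega> \<mu>"
proof -
  interpret r: flow_domain "\<lambda>x t. \<Phi> x (- t)" \<Omega> by (rule reverse)
  show ?thesis by standard (use sets_mu invariant in auto)
qed

lemma nn_integral_flow:
  assumes [measurable]: "k \<in> borel_measurable borel"
  shows "(\<integral>\<^sup>+x. k (\<Phi> x t) \<partial>\<mu>) = integral\<^sup>N \<mu> k"
proof -
  have "integral\<^sup>N \<mu> k = integral\<^sup>N (distr \<mu> borel (\<lambda>x. \<Phi> x t)) k"
    by (simp add: invariant)
  also have "\<dots> = (\<integral>\<^sup>+x. k (\<Phi> x t) \<partial>\<mu>)" by (rule nn_integral_distr) measurable
  finally show ?thesis ..
qed

lemma domain_borel [measurable]: "\<Omega> \<in> sets borel"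
  using open_domain by simp

definition escaping :: "'a set" where "escaping = {x \<in> \<Omega>. tau_plus \<Phi> \<Omega> x < \<infinity>}"

definition exit_after :: "'a \<Rightarrow> real" where "exit_after x = real_of_ereal (tau_plus \<Phi> \<Omega> x)"

definition exit_point :: "'a \<Rightarrow> 'a" where "exit_point x = \<Phi> x (exit_after x)"

text \<open>
  A positive length that fits into the trajectory ending at \<open>y\<close>, also when that trajectory is
  infinitely long.
\<close>

definition window :: "'a \<Rightarrow> real" where "window y = real_of_ereal (min 1 (tau_minus \<Phi> \<Omega> y))"

text \<open>
  The only property that matters is that the integral of \<open>weight\<close> along each trajectory that
  leaves \<open>\<Omega>\<close> is \<open>1\<close>: here it is the uniform density on the final stretch of length \<open>window\<close>.
\<close>

definition weight :: "'a \<Rightarrow> ennreal" where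
  "weight x = indicator {x. exit_after x < window (exit_point x)} x * ennreal (1 / window (exit_point x))"

text \<open>
  If \<open>\<mu>\<close> is to be \<open>outflow \<Otimes> ds\<close> in the coordinates given by exit point and time to exit, then
  integrating \<open>weight\<close> along the trajectories has to recover \<open>outflow\<close>. This leaves no other choice
  than the image of \<open>weight \<cdot> \<mu>\<close> under the exit point map.
\<close>

definition outflow :: "'a measure" where
  "outflow = distr (density (restrict_space \<mu> escaping) weight) (restrict_space borel (Gamma_plus \<Phi> \<Omega>)) exit_point"

lemma escaping_borel [measurable]: "escaping \<in> sets borel"
proof -
  have "escaping = {x\<in>space borel. x \<in> \<Omega> \<and> tau_plus \<Phi> \<Omega> x < \<infinity>}" by (simp add: escaping_def)
  also have "\<dots> \<in> sets borel" by measurable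
  finally show ?thesis .
qed

lemma exit_after_measurable [measurable]: "exit_after \<in> borel_measurable borel"
  unfolding exit_after_def by measurable

lemma exit_point_measurable [measurable]: "exit_point \<in> borel_measurable borel"
  unfolding exit_point_def by measurable

lemma window_measurable [measurable]: "window \<in> borel_measurable borel"
  unfolding window_def by measurable

lemma weight_measurable [measurable]: "weight \<in> borel_measurable borel"
  unfolding weight_def by measurable

lemma escapingD:
  assumes "x \<in> escaping"
  shows "x \<in> \<Omega>" "tau_plus \<Phi> \<Omega> x = ereal (exit_after x)" "0 < exit_after x"
    "exit_point x \<in> Gamma_plus \<Phi> \<Omega>" "ereal (exit_after x) < tau_minus \<Phi> \<Omega> (exit_point x)"
    "\<Phi> (exit_point x) (- exit_after x) = x"
proof -
  show x: "x \<in> \<Omega>" using assms by (simp add: escaping_def)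
  show t: "tau_plus \<Phi> \<Omega> x = ereal (exit_after x)"
    using exit_time_pos[OF x, of 1] assms unfolding escaping_def exit_after_def
    by (cases "tau_plus \<Phi> \<Omega> x") auto
  show "0 < exit_after x" "exit_point x \<in> Gamma_plus \<Phi> \<Omega>" "ereal (exit_after x) < tau_minus \<Phi> \<Omega> (exit_point x)"
    using forwards_to_boundary[OF x t] by (simp_all add: exit_point_def)
  show "\<Phi> (exit_point x) (- exit_after x) = x" by (simp add: exit_point_def)
qed

lemma backwards_escaping:
  assumes "y \<in> Gamma_plus \<Phi> \<Omega>" "0 < s" "ereal s < tau_minus \<Phi> \<Omega> y"
  shows "\<Phi> y (- s) \<in> escaping" "exit_after (\<Phi> y (- s)) = s" "exit_point (\<Phi> y (- s)) = y"
  using backwards_from_boundary[OF assms] by (auto simp: escaping_def exit_after_def exit_point_def)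

text \<open>
  Moving along a trajectory changes only the time coordinate.
\<close>

lemma shift_escaping:
  assumes x: "x \<in> escaping" and r: "r < exit_after x"
    "ereal (exit_after x - r) < tau_minus \<Phi> \<Omega> (exit_point x)"
  shows "\<Phi> x r \<in> escaping" "exit_after (\<Phi> x r) = exit_after x - r" "exit_point (\<Phi> x r) = exit_point x"
proof -
  have "\<Phi> x r = \<Phi> (exit_point x) (- (exit_after x - r))" by (simp add: exit_point_def)
  then show "\<Phi> x r \<in> escaping" "exit_after (\<Phi> x r) = exit_after x - r" "exit_point (\<Phi> x r) = exit_point x"
    using backwards_escaping[OF escapingD(4)[OF x], of "exit_after x - r"] r by simp_all
qed

lemma window:
  assumes "y \<in> Gamma_plus \<Phi> \<Omega>"
  shows "0 < window y" "ereal (window y) \<le> tau_minus \<Phi> \<Omega> y"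
proof -
  have "0 < tau_minus \<Phi> \<Omega> y" using assms by (rule outgoing_boundary_exit_time_pos)
  then show "0 < window y" "ereal (window y) \<le> tau_minus \<Phi> \<Omega> y"
    unfolding window_def by (cases "tau_minus \<Phi> \<Omega> y"; auto simp: min_def)+
qed

lemma space_outflow [simp]: "space outflow = Gamma_plus \<Phi> \<Omega>"
  and sets_outflow: "sets outflow = sets (restrict_space borel (Gamma_plus \<Phi> \<Omega>))"
  by (simp_all add: outflow_def space_restrict_space)

lemma outflow_to_borel [measurable]: "(\<lambda>y. y) \<in> outflow \<rightarrow>\<^sub>M borel"
  using measurable_restrict_space1[OF measurable_ident, of borel "Gamma_plus \<Phi> \<Omega>"]
  by (simp add: id_def measurable_cong_sets[OF sets_outflow refl])

lemma nn_integral_outflow: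
  assumes k: "k \<in> borel_measurable outflow"
  shows "integral\<^sup>N outflow k = (\<integral>\<^sup>+x. indicator escaping x * (weight x * k (exit_point x)) \<partial>\<mu>)"
proof -
  let ?R = "restrict_space \<mu> escaping"
  have k' [measurable]: "k \<in> borel_measurable (restrict_space borel (Gamma_plus \<Phi> \<Omega>))"
    using k by (simp add: measurable_cong_sets[OF sets_outflow refl])
  have ep [measurable]: "exit_point \<in> ?R \<rightarrow>\<^sub>M restrict_space borel (Gamma_plus \<Phi> \<Omega>)"
  proof (intro measurable_restrict_space2 measurable_restrict_space1)
    show "exit_point \<in> borel_measurable \<mu>" by (simp add: measurable_cong_sets[OF sets_mu refl])
  qed (auto simp: space_restrict_space escapingD)
  have w [measurable]: "weight \<in> borel_measurable ?R" by (intro measurable_restrict_space1) (simp add: measurable_cong_sets[OF sets_mu refl])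
  have "integral\<^sup>N outflow k = (\<integral>\<^sup>+x. weight x * k (exit_point x) \<partial>?R)"
    unfolding outflow_def by (simp add: nn_integral_distr nn_integral_density)
  also have "\<dots> = (\<integral>\<^sup>+x. weight x * k (exit_point x) * indicator escaping x \<partial>\<mu>)"
    by (rule nn_integral_restrict_space) (simp add: sets_mu)
  finally show ?thesis by (simp add: mult.commute)
qed

lemma nn_integral_window:
  assumes "0 < l"
  shows "(\<integral>\<^sup>+r. indicator {0<..<l} (a + r) * ennreal (1 / l) \<partial>lborel) = 1"
proof -
  have "(\<integral>\<^sup>+r. indicator {0<..<l} (a + r) * ennreal (1 / l) \<partial>lborel) =
      (\<integral>\<^sup>+r. indicator {0<..<l} r * ennreal (1 / l) \<partial>lborel)"
    using nn_integral_real_affine[of "\<lambda>r. indicator {0<..<l} r * ennreal (1 / l)" 1 a] by simp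
  also have "\<dots> = ennreal l * ennreal (1 / l)"
    using assms by (simp add: nn_integral_multc)
  also have "\<dots> = 1" using assms by (simp flip: ennreal_mult)
  finally show ?thesis .
qed

text \<open>
  The heart of the construction. By definition of \<open>outflow\<close>, the left-hand side is the integral over
  \<open>x\<close> of \<open>weight x\<close> times the integral of \<open>H\<close> over the entire trajectory through \<open>x\<close>, i.e. a double
  integral of \<open>weight x \<cdot> H (\<Phi> x r)\<close> over \<open>x\<close> and \<open>r\<close> with \<open>H\<close> read as a function of points of \<open>\<Omega>\<close>.
  For fixed \<open>r\<close>, invariance of \<open>\<mu>\<close> permits the substitution \<open>z = \<Phi> x r\<close>, after which the weight
  occurs as \<open>weight (\<Phi> z (- r))\<close> and integrates to \<open>1\<close> over \<open>r\<close>.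
\<close>

lemma nn_integral_along_trajectories:
  assumes H [measurable]: "H \<in> borel_measurable (borel \<Otimes>\<^sub>M borel)"
  shows "(\<integral>\<^sup>+y. \<integral>\<^sup>+s. indicator (einterval 0 (tau_minus \<Phi> \<Omega> y)) s * H (y, s) \<partial>lborel \<partial>outflow) =
    (\<integral>\<^sup>+x. indicator escaping x * H (exit_point x, exit_after x) \<partial>\<mu>)"
proof -
  interpret MuL: pair_sigma_finite \<mu> lborel ..
  define K where "K y s = (if 0 < s \<and> ereal s < tau_minus \<Phi> \<Omega> y then H (y, s) else 0)" for y s
  have K [measurable]: "(\<lambda>z. K (f z) (g z)) \<in> borel_measurable M"
    if [measurable]: "f \<in> borel_measurable M" "g \<in> borel_measurable M" for M :: "'c measure" and f g
    unfolding K_def by measurable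
  have K_ind: "indicator (einterval 0 (tau_minus \<Phi> \<Omega> y)) s * H (y, s) = K y s" for y s
    by (auto simp: K_def einterval_iff indicator_def)
  define V where "V x r = indicator escaping x * (weight x * K (exit_point x) (exit_after x - r))" for x r
  have V [measurable]: "(\<lambda>z. V (f z) (g z)) \<in> borel_measurable M"
    if [measurable]: "f \<in> borel_measurable M" "g \<in> borel_measurable M" for M :: "'c measure" and f g
    unfolding V_def by measurable
  have "(\<integral>\<^sup>+y. \<integral>\<^sup>+s. indicator (einterval 0 (tau_minus \<Phi> \<Omega> y)) s * H (y, s) \<partial>lborel \<partial>outflow) =
      (\<integral>\<^sup>+y. \<integral>\<^sup>+s. K y s \<partial>lborel \<partial>outflow)" by (simp only: K_ind)
  also have "\<dots> = (\<integral>\<^sup>+x. indicator escaping x * (weight x * (\<integral>\<^sup>+s. K (exit_point x) s \<partial>lborel)) \<partial>\<mu>)"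
    by (rule nn_integral_outflow) measurable
  also have "\<dots> = (\<integral>\<^sup>+x. \<integral>\<^sup>+r. V x r \<partial>lborel \<partial>\<mu>)"
  proof (intro nn_integral_cong)
    fix x
    have "(\<integral>\<^sup>+s. K (exit_point x) s \<partial>lborel) = (\<integral>\<^sup>+r. K (exit_point x) (exit_after x - r) \<partial>lborel)"
      using nn_integral_real_affine[of "K (exit_point x)" "-1" "exit_after x"] by simp
    then show "indicator escaping x * (weight x * (\<integral>\<^sup>+s. K (exit_point x) s \<partial>lborel)) = (\<integral>\<^sup>+r. V x r \<partial>lborel)"
      unfolding V_def by (simp add: nn_integral_cmult)
  qed
  also have "\<dots> = (\<integral>\<^sup>+r. \<integral>\<^sup>+x. V x r \<partial>\<mu> \<partial>lborel)"
    by (rule MuL.Fubini'[symmetric]) measurable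
  \<comment> \<open>Here the invariance of \<open>\<mu>\<close> enters.\<close>
  also have "\<dots> = (\<integral>\<^sup>+r. \<integral>\<^sup>+z. V (\<Phi> z (- r)) r \<partial>\<mu> \<partial>lborel)"
    by (intro nn_integral_cong nn_integral_flow[symmetric]) measurable
  also have "\<dots> = (\<integral>\<^sup>+z. \<integral>\<^sup>+r. V (\<Phi> z (- r)) r \<partial>lborel \<partial>\<mu>)"
    by (rule MuL.Fubini') measurable
  also have "\<dots> = (\<integral>\<^sup>+x. indicator escaping x * H (exit_point x, exit_after x) \<partial>\<mu>)"
  proof (intro nn_integral_cong)
    fix z
    let ?l = "window (exit_point z)"
    have "V (\<Phi> z (- r)) r = indicator escaping z * H (exit_point z, exit_after z) *
        (indicator {0<..<?l} (exit_after z + r) * ennreal (1 / ?l))" for r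
    proof (cases "z \<in> escaping \<and> - r < exit_after z \<and> ereal (exit_after z + r) < tau_minus \<Phi> \<Omega> (exit_point z)")
      case True
      then have "\<Phi> z (- r) \<in> escaping" "exit_after (\<Phi> z (- r)) = exit_after z + r"
          "exit_point (\<Phi> z (- r)) = exit_point z"
        using shift_escaping[of z "- r"] by auto
      then show ?thesis
        using True escapingD[of z] by (auto simp: V_def K_def weight_def indicator_def ac_simps)
    next
      case False
      have "V (\<Phi> z (- r)) r = 0"
      proof (rule ccontr)
        let ?x = "\<Phi> z (- r)"
        assume "V ?x r \<noteq> 0"
        then have x: "?x \<in> escaping" "r < exit_after ?x"
            "ereal (exit_after ?x - r) < tau_minus \<Phi> \<Omega> (exit_point ?x)"
          by (auto simp: V_def K_def indicator_def split: if_splits)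
        from shift_escaping[OF x] have "z \<in> escaping" "exit_after z = exit_after ?x - r" "exit_point z = exit_point ?x"
          by simp_all
        with False x escapingD[OF x(1)] show False by auto
      qed
      moreover have "ereal (exit_after z + r) < tau_minus \<Phi> \<Omega> (exit_point z)"
        if "z \<in> escaping" "exit_after z + r < ?l"
        using window(2)[OF escapingD(4)[OF that(1)]] that(2)
        by (meson less_ereal.simps(1) less_le_trans)
      ultimately show ?thesis using False by (auto simp: indicator_def)
    qed
    then have "(\<integral>\<^sup>+r. V (\<Phi> z (- r)) r \<partial>lborel) = indicator escaping z * H (exit_point z, exit_after z) *
        (\<integral>\<^sup>+r. indicator {0<..<?l} (exit_after z + r) * ennreal (1 / ?l) \<partial>lborel)"
      by (simp add: nn_integral_cmult)
    also have "\<dots> = indicator escaping z * H (exit_point z, exit_after z)"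
      using nn_integral_window[OF window(1)[OF escapingD(4)], of z] by (cases "z \<in> escaping") auto
    finally show "(\<integral>\<^sup>+r. V (\<Phi> z (- r)) r \<partial>lborel) = indicator escaping z * H (exit_point z, exit_after z)" .
  qed
  finally show ?thesis .
qed


text \<open>
  A positive integrable function on the interior yields, by integration along the trajectories, one on
  the boundary.
\<close>

lemma sigma_finite_outflow: "sigma_finite_measure outflow"
proof -
  obtain h where h [measurable]: "h \<in> borel_measurable \<mu>"
    and fin: "integral\<^sup>N \<mu> h \<noteq> \<infinity>" and pos: "\<And>x. x \<in> space \<mu> \<Longrightarrow> 0 < h x \<and> h x < \<infinity>"
    using Ex_finite_integrable_function by blast
  have sp: "space \<mu> = UNIV" using sets_eq_imp_space_eq[OF sets_mu] by simp
  have h' [measurable]: "h \<in> borel_measurable borel" using h by (simp add: measurable_cong_sets[OF sets_mu refl])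
  define k where "k y = (\<integral>\<^sup>+s. indicator (einterval 0 (tau_minus \<Phi> \<Omega> y)) s * h (\<Phi> y (- s)) \<partial>lborel)" for y
  have ind: "indicator (einterval 0 (tau_minus \<Phi> \<Omega> y)) s * h (\<Phi> y (- s)) =
      (if 0 < s \<and> ereal s < tau_minus \<Phi> \<Omega> y then h (\<Phi> y (- s)) else 0)" for y s
    by (auto simp: einterval_iff indicator_def)
  show ?thesis
  proof (rule sigma_finite_measureI_positive_integrable)
    show "k \<in> borel_measurable outflow" unfolding k_def ind by measurable
    have "integral\<^sup>N outflow k = (\<integral>\<^sup>+x. indicator escaping x * h (\<Phi> (exit_point x) (- exit_after x)) \<partial>\<mu>)"
      unfolding k_def using nn_integral_along_trajectories[of "\<lambda>(y, s). h (\<Phi> y (- s))"] by simp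
    also have "\<dots> \<le> integral\<^sup>N \<mu> h"
      using escapingD(6) by (intro nn_integral_mono) (auto simp: indicator_def)
    also have "\<dots> < \<infinity>" using fin by (simp add: less_top)
    finally show "integral\<^sup>N outflow k < \<infinity>" .
    show "0 < k y" if y: "y \<in> space outflow" for y
    proof -
      have [measurable]: "(\<lambda>s. h (\<Phi> y (- s))) \<in> borel_measurable borel" by measurable
      show ?thesis
        unfolding k_def using outgoing_boundary_exit_time_pos[of y] y pos sp
        by (intro nn_integral_einterval_pos) auto
    qed
  qed
qed

text \<open>
  Follow the point \<open>(x, r)\<close> of \<open>\<Omega> \<times> {0<..<T}\<close> along \<open>(\<Phi> x u, r + u)\<close>. Either it leaves \<open>\<Omega>\<close> before time
  \<open>T\<close>, i.e. \<open>tau_plus x < T - r\<close>, or it is still in \<open>\<Omega>\<close> at time \<open>T\<close>, i.e. \<open>T - r < tau_plus x\<close>. The points of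
  the first kind are parametrized by the point and time of exit and account for the boundary term.
  Those of the second kind are parametrized by their position at time \<open>T\<close>, and for these invariance of
  \<open>\<mu>\<close> gives the interior term. For each \<open>x\<close> the remaining case \<open>r = T - tau_plus x\<close> concerns a single
  time.
\<close>

lemma outgoing_formula:
  assumes F [measurable]: "F \<in> borel_measurable (borel \<Otimes>\<^sub>M borel)"
  shows "(\<integral>\<^sup>+x. indicator \<Omega> x * (\<integral>\<^sup>+t. indicator {0<..<T} t * F (x, t) \<partial>lborel) \<partial>\<mu>) =
    (\<integral>\<^sup>+t. indicator {0<..<T} t * (\<integral>\<^sup>+y. \<integral>\<^sup>+s. indicator (einterval 0 (min (tau_minus \<Phi> \<Omega> y) (ereal t))) s * F (\<Phi> y (- s), t - s) \<partial>lborel \<partial>outflow) \<partial>lborel) +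
    (\<integral>\<^sup>+x. indicator \<Omega> x * (\<integral>\<^sup>+s. indicator (einterval 0 (min (tau_minus \<Phi> \<Omega> x) (ereal T))) s * F (\<Phi> x (- s), T - s) \<partial>lborel) \<partial>\<mu>)"
    (is "?L = ?Bd + ?Int")
proof -
  interpret MuL: pair_sigma_finite \<mu> lborel ..
  interpret O: sigma_finite_measure outflow by (rule sigma_finite_outflow)
  interpret OL: pair_sigma_finite outflow lborel ..
  have Fm [measurable]: "(\<lambda>z. F (f z, g z)) \<in> borel_measurable M"
    if [measurable]: "f \<in> borel_measurable M" "g \<in> borel_measurable M" for M :: "'c measure" and f g
    by measurable
  have "?Bd = (\<integral>\<^sup>+t. \<integral>\<^sup>+y. \<integral>\<^sup>+s. (if 0 < t \<and> t < T \<and> 0 < s \<and> s < t \<and> ereal s < tau_minus \<Phi> \<Omega> y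
      then F (\<Phi> y (- s), t - s) else 0) \<partial>lborel \<partial>outflow \<partial>lborel)"
  proof (rule nn_integral_cong)
    fix t
    show "indicator {0<..<T} t * (\<integral>\<^sup>+y. \<integral>\<^sup>+s. indicator (einterval 0 (min (tau_minus \<Phi> \<Omega> y) (ereal t))) s * F (\<Phi> y (- s), t - s) \<partial>lborel \<partial>outflow)
      = (\<integral>\<^sup>+y. \<integral>\<^sup>+s. (if 0 < t \<and> t < T \<and> 0 < s \<and> s < t \<and> ereal s < tau_minus \<Phi> \<Omega> y
      then F (\<Phi> y (- s), t - s) else 0) \<partial>lborel \<partial>outflow)"
      by (cases "0 < t \<and> t < T") (auto simp: einterval_iff indicator_def intro!: nn_integral_cong)
  qed
  also have "\<dots> = (\<integral>\<^sup>+y. \<integral>\<^sup>+t. \<integral>\<^sup>+s. (if 0 < t \<and> t < T \<and> 0 < s \<and> s < t \<and> ereal s < tau_minus \<Phi> \<Omega> y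
      then F (\<Phi> y (- s), t - s) else 0) \<partial>lborel \<partial>lborel \<partial>outflow)"
    by (rule OL.Fubini') measurable
  also have "\<dots> = (\<integral>\<^sup>+y. \<integral>\<^sup>+s. \<integral>\<^sup>+t. (if 0 < t \<and> t < T \<and> 0 < s \<and> s < t \<and> ereal s < tau_minus \<Phi> \<Omega> y
      then F (\<Phi> y (- s), t - s) else 0) \<partial>lborel \<partial>lborel \<partial>outflow)"
    by (intro nn_integral_cong lborel_pair.Fubini') measurable
  also have "\<dots> = (\<integral>\<^sup>+y. \<integral>\<^sup>+s. indicator (einterval 0 (tau_minus \<Phi> \<Omega> y)) s *
      (\<integral>\<^sup>+t. (if s < t \<and> t < T then F (\<Phi> y (- s), t - s) else 0) \<partial>lborel) \<partial>lborel \<partial>outflow)"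
  proof (intro nn_integral_cong)
    fix y s
    show "(\<integral>\<^sup>+t. (if 0 < t \<and> t < T \<and> 0 < s \<and> s < t \<and> ereal s < tau_minus \<Phi> \<Omega> y
      then F (\<Phi> y (- s), t - s) else 0) \<partial>lborel) = indicator (einterval 0 (tau_minus \<Phi> \<Omega> y)) s *
      (\<integral>\<^sup>+t. (if s < t \<and> t < T then F (\<Phi> y (- s), t - s) else 0) \<partial>lborel)"
      by (cases "s \<in> einterval 0 (tau_minus \<Phi> \<Omega> y)")
         (auto simp: einterval_iff intro!: nn_integral_cong)
  qed
  also have "\<dots> = (\<integral>\<^sup>+x. indicator escaping x *
      (\<integral>\<^sup>+t. (if exit_after x < t \<and> t < T then F (x, t - exit_after x) else 0) \<partial>lborel) \<partial>\<mu>)"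
  proof -
    have "(\<lambda>z. \<integral>\<^sup>+t. (if snd z < t \<and> t < T then F (\<Phi> (fst z) (- snd z), t - snd z) else 0) \<partial>lborel)
        \<in> borel_measurable (borel \<Otimes>\<^sub>M borel)" by measurable
    note * = nn_integral_along_trajectories[OF this, unfolded fst_conv snd_conv]
    have "indicator escaping x * (\<integral>\<^sup>+t. (if exit_after x < t \<and> t < T
          then F (\<Phi> (exit_point x) (- exit_after x), t - exit_after x) else 0) \<partial>lborel) =
        indicator escaping x * (\<integral>\<^sup>+t. (if exit_after x < t \<and> t < T then F (x, t - exit_after x) else 0) \<partial>lborel)" for x
      using escapingD(6)[of x] by (cases "x \<in> escaping") (simp_all cong: if_cong)
    then show ?thesis unfolding * by simp
  qed
  also have "\<dots> = (\<integral>\<^sup>+x. \<integral>\<^sup>+r. (if x \<in> escaping \<and> 0 < r \<and> exit_after x + r < T then F (x, r) else 0) \<partial>lborel \<partial>\<mu>)"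
  proof (rule nn_integral_cong)
    fix x
    have "(\<integral>\<^sup>+t. (if exit_after x < t \<and> t < T then F (x, t - exit_after x) else 0) \<partial>lborel) =
        (\<integral>\<^sup>+r. (if 0 < r \<and> exit_after x + r < T then F (x, r) else 0) \<partial>lborel)"
      using nn_integral_real_affine[of "\<lambda>t. if exit_after x < t \<and> t < T then F (x, t - exit_after x) else 0" 1 "exit_after x"]
      by (simp cong: if_cong)
    then show "indicator escaping x * (\<integral>\<^sup>+t. (if exit_after x < t \<and> t < T then F (x, t - exit_after x) else 0) \<partial>lborel) =
        (\<integral>\<^sup>+r. (if x \<in> escaping \<and> 0 < r \<and> exit_after x + r < T then F (x, r) else 0) \<partial>lborel)"
      by (cases "x \<in> escaping") auto
  qed
  finally have Bd: "?Bd = \<dots>" .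
  have "?Int = (\<integral>\<^sup>+x. \<integral>\<^sup>+s. (if x \<in> \<Omega> \<and> 0 < s \<and> s < T \<and> ereal s < tau_minus \<Phi> \<Omega> x then F (\<Phi> x (- s), T - s) else 0) \<partial>lborel \<partial>\<mu>)"
  proof (rule nn_integral_cong)
    fix x
    show "indicator \<Omega> x * (\<integral>\<^sup>+s. indicator (einterval 0 (min (tau_minus \<Phi> \<Omega> x) (ereal T))) s * F (\<Phi> x (- s), T - s) \<partial>lborel)
      = (\<integral>\<^sup>+s. (if x \<in> \<Omega> \<and> 0 < s \<and> s < T \<and> ereal s < tau_minus \<Phi> \<Omega> x then F (\<Phi> x (- s), T - s) else 0) \<partial>lborel)"
      by (cases "x \<in> \<Omega>") (auto simp: einterval_iff indicator_def intro!: nn_integral_cong)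
  qed
  also have "\<dots> = (\<integral>\<^sup>+s. \<integral>\<^sup>+x. (if x \<in> \<Omega> \<and> 0 < s \<and> s < T \<and> ereal s < tau_minus \<Phi> \<Omega> x then F (\<Phi> x (- s), T - s) else 0) \<partial>\<mu> \<partial>lborel)"
    by (rule MuL.Fubini'[symmetric]) measurable
  also have "\<dots> = (\<integral>\<^sup>+s. \<integral>\<^sup>+x. (if x \<in> \<Omega> \<and> 0 < s \<and> s < T \<and> ereal s < tau_plus \<Phi> \<Omega> x then F (x, T - s) else 0) \<partial>\<mu> \<partial>lborel)"
  proof (rule nn_integral_cong)
    fix s :: real
    define k where "k x = (if x \<in> \<Omega> \<and> 0 < s \<and> s < T \<and> ereal s < tau_plus \<Phi> \<Omega> x then F (x, T - s) else 0)" for x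
    have "k \<in> borel_measurable borel" unfolding k_def by measurable
    note k = nn_integral_flow[OF this, of "- s"]
    have *: "(if x \<in> \<Omega> \<and> 0 < s \<and> s < T \<and> ereal s < tau_minus \<Phi> \<Omega> x then F (\<Phi> x (- s), T - s) else 0) =
        k (\<Phi> x (- s))" for x
    proof (cases "0 < s")
      case True
      show ?thesis
        using less_exit_time_shift[OF True, of x] unfolding k_def
        by (cases "x \<in> \<Omega> \<and> ereal s < tau_minus \<Phi> \<Omega> x") auto
    qed (simp add: k_def)
    show "(\<integral>\<^sup>+x. (if x \<in> \<Omega> \<and> 0 < s \<and> s < T \<and> ereal s < tau_minus \<Phi> \<Omega> x then F (\<Phi> x (- s), T - s) else 0) \<partial>\<mu>) =
      (\<integral>\<^sup>+x. (if x \<in> \<Omega> \<and> 0 < s \<and> s < T \<and> ereal s < tau_plus \<Phi> \<Omega> x then F (x, T - s) else 0) \<partial>\<mu>)"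
      unfolding * k by (simp only: k_def[abs_def])
  qed
  also have "\<dots> = (\<integral>\<^sup>+x. \<integral>\<^sup>+s. (if x \<in> \<Omega> \<and> 0 < s \<and> s < T \<and> ereal s < tau_plus \<Phi> \<Omega> x then F (x, T - s) else 0) \<partial>lborel \<partial>\<mu>)"
    by (rule MuL.Fubini') measurable
  also have "\<dots> = (\<integral>\<^sup>+x. \<integral>\<^sup>+r. (if x \<in> \<Omega> \<and> 0 < r \<and> r < T \<and> ereal (T - r) < tau_plus \<Phi> \<Omega> x then F (x, r) else 0) \<partial>lborel \<partial>\<mu>)"
  proof (rule nn_integral_cong)
    fix x
    have "(\<integral>\<^sup>+s. (if x \<in> \<Omega> \<and> 0 < s \<and> s < T \<and> ereal s < tau_plus \<Phi> \<Omega> x then F (x, T - s) else 0) \<partial>lborel) =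
      (\<integral>\<^sup>+r. (if x \<in> \<Omega> \<and> r < T \<and> 0 < r \<and> ereal (T - r) < tau_plus \<Phi> \<Omega> x then F (x, r) else 0) \<partial>lborel)"
      using nn_integral_real_affine[of "\<lambda>s. if x \<in> \<Omega> \<and> 0 < s \<and> s < T \<and> ereal s < tau_plus \<Phi> \<Omega> x then F (x, T - s) else 0" "-1" T]
      by (simp cong: if_cong)
    then show "(\<integral>\<^sup>+s. (if x \<in> \<Omega> \<and> 0 < s \<and> s < T \<and> ereal s < tau_plus \<Phi> \<Omega> x then F (x, T - s) else 0) \<partial>lborel) =
      (\<integral>\<^sup>+r. (if x \<in> \<Omega> \<and> 0 < r \<and> r < T \<and> ereal (T - r) < tau_plus \<Phi> \<Omega> x then F (x, r) else 0) \<partial>lborel)"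
      by (simp add: conj_ac)
  qed
  finally have Int: "?Int = \<dots>" .
  have "?Bd + ?Int = (\<integral>\<^sup>+x. (\<integral>\<^sup>+r. (if x \<in> escaping \<and> 0 < r \<and> exit_after x + r < T then F (x, r) else 0) \<partial>lborel) +
      (\<integral>\<^sup>+r. (if x \<in> \<Omega> \<and> 0 < r \<and> r < T \<and> ereal (T - r) < tau_plus \<Phi> \<Omega> x then F (x, r) else 0) \<partial>lborel) \<partial>\<mu>)"
    unfolding Bd Int by (rule nn_integral_add[symmetric]) measurable
  also have "\<dots> = ?L"
  proof (rule nn_integral_cong)
    fix x
    have "(\<integral>\<^sup>+r. (if x \<in> escaping \<and> 0 < r \<and> exit_after x + r < T then F (x, r) else 0) \<partial>lborel) +
      (\<integral>\<^sup>+r. (if x \<in> \<Omega> \<and> 0 < r \<and> r < T \<and> ereal (T - r) < tau_plus \<Phi> \<Omega> x then F (x, r) else 0) \<partial>lborel) =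
      (\<integral>\<^sup>+r. (if x \<in> escaping \<and> 0 < r \<and> exit_after x + r < T then F (x, r) else 0) +
        (if x \<in> \<Omega> \<and> 0 < r \<and> r < T \<and> ereal (T - r) < tau_plus \<Phi> \<Omega> x then F (x, r) else 0) \<partial>lborel)"
      by (rule nn_integral_add[symmetric]) measurable
    also have "\<dots> = (\<integral>\<^sup>+r. indicator \<Omega> x * (indicator {0<..<T} r * F (x, r)) \<partial>lborel)"
    proof (rule nn_integral_cong_AE)
      show "AE r in lborel. (if x \<in> escaping \<and> 0 < r \<and> exit_after x + r < T then F (x, r) else 0) +
        (if x \<in> \<Omega> \<and> 0 < r \<and> r < T \<and> ereal (T - r) < tau_plus \<Phi> \<Omega> x then F (x, r) else 0) =
        indicator \<Omega> x * (indicator {0<..<T} r * F (x, r))"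
        using AE_lborel_singleton[of "T - exit_after x"]
      proof eventually_elim
        fix r assume r: "r \<noteq> T - exit_after x"
        consider "x \<in> escaping" | "x \<in> \<Omega>" "x \<notin> escaping" "tau_plus \<Phi> \<Omega> x = \<infinity>" | "x \<notin> \<Omega>" "x \<notin> escaping"
          by (auto simp: escaping_def)
        then show "(if x \<in> escaping \<and> 0 < r \<and> exit_after x + r < T then F (x, r) else 0) +
          (if x \<in> \<Omega> \<and> 0 < r \<and> r < T \<and> ereal (T - r) < tau_plus \<Phi> \<Omega> x then F (x, r) else 0) =
          indicator \<Omega> x * (indicator {0<..<T} r * F (x, r))"
        proof cases
          case 1
          then show ?thesis using escapingD(1-3)[OF 1] r by (auto simp: indicator_def)
        qed (auto simp: indicator_def)
      qed
    qed
    also have "\<dots> = indicator \<Omega> x * (\<integral>\<^sup>+r. indicator {0<..<T} r * F (x, r) \<partial>lborel)"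
      by (rule nn_integral_cmult) measurable
    finally show "(\<integral>\<^sup>+r. (if x \<in> escaping \<and> 0 < r \<and> exit_after x + r < T then F (x, r) else 0) \<partial>lborel) +
      (\<integral>\<^sup>+r. (if x \<in> \<Omega> \<and> 0 < r \<and> r < T \<and> ereal (T - r) < tau_plus \<Phi> \<Omega> x then F (x, r) else 0) \<partial>lborel) =
      indicator \<Omega> x * (\<integral>\<^sup>+r. indicator {0<..<T} r * F (x, r) \<partial>lborel)" .
  qed
  finally show ?thesis ..
qed

end

section \<open>Existence\<close>

text \<open>
  The formula that characterizes the outgoing measure, for both boundaries at once: with \<open>\<theta> t = t\<close> it
  is the one for \<open>\<mu>\<^sub>+\<close>. For the reversed flow and the reflection \<open>\<theta> t = T - t\<close> it is the
  one for \<open>\<mu>\<^sub>-\<close>, because then \<open>\<theta> (\<theta> t - s) = t + s\<close> and \<open>\<theta> (T - s) = s\<close>.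
\<close>

definition outgoing_representation ::
    "('a::euclidean_space \<Rightarrow> real \<Rightarrow> 'a) \<Rightarrow> 'a set \<Rightarrow> 'a measure \<Rightarrow> (real \<Rightarrow> real) \<Rightarrow> 'a measure \<Rightarrow> real \<Rightarrow> ('a \<times> real \<Rightarrow> real) \<Rightarrow> bool" where
  "outgoing_representation \<Phi> \<Omega> \<mu> \<theta> P T f \<longleftrightarrow>
      boundary_integral_exists T P (\<lambda>t y. min (tau_minus_bd \<Phi> \<Omega> y) (ereal (\<theta> t)))
        (\<lambda>t y s. f (\<Phi> y (- s), \<theta> (\<theta> t - s))) \<and>
      interior_integral_exists \<Omega> \<mu> (\<lambda>x. min (tau_minus \<Phi> \<Omega> x) (ereal T)) (\<lambda>x s. f (\<Phi> x (- s), \<theta> (T - s))) \<and>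
      (LINT z|mu_T \<mu> \<Omega> T. f z) =
        (LINT t=0..ereal T|lebesgue. (LINT y|completion P.
           (LINT s=0..min (tau_minus_bd \<Phi> \<Omega> y) (ereal (\<theta> t))|lebesgue. f (\<Phi> y (- s), \<theta> (\<theta> t - s))))) +
        (LINT x:\<Omega>|completion \<mu>.
           (LINT s=0..min (tau_minus \<Phi> \<Omega> x) (ereal T)|lebesgue. f (\<Phi> x (- s), \<theta> (T - s))))"

context invariant_flow
begin

lemma nn_integral_reflect:
  fixes u :: "real \<Rightarrow> ennreal"
  assumes [measurable]: "u \<in> borel_measurable borel" and \<theta>: "\<theta> = (\<lambda>t. t) \<or> \<theta> = (\<lambda>t. T - t)"
  shows "(\<integral>\<^sup>+t. indicator {0<..<T} t * u (\<theta> t) \<partial>lborel) = (\<integral>\<^sup>+t. indicator {0<..<T} t * u t \<partial>lborel)"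
  using \<theta>
proof
  assume "\<theta> = (\<lambda>t. T - t)"
  moreover have "indicator {0<..<T} (T - t) = (indicator {0<..<T} t :: ennreal)" for t
    by (auto simp: indicator_def)
  ultimately show ?thesis
    using nn_integral_real_affine[of "\<lambda>t. indicator {0<..<T} t * u t" "-1" T] by simp
qed simp

lemma outgoing_formula_time_reversal:
  assumes F [measurable]: "F \<in> borel_measurable (borel \<Otimes>\<^sub>M borel)" and \<theta>: "\<theta> = (\<lambda>t. t) \<or> \<theta> = (\<lambda>t. T - t)"
  shows "(\<integral>\<^sup>+x. indicator \<Omega> x * (\<integral>\<^sup>+t. indicator {0<..<T} t * F (x, t) \<partial>lborel) \<partial>\<mu>) =
    (\<integral>\<^sup>+t. indicator {0<..<T} t * (\<integral>\<^sup>+y. \<integral>\<^sup>+s. indicator (einterval 0 (min (tau_minus \<Phi> \<Omega> y) (ereal (\<theta> t)))) s * F (\<Phi> y (- s), \<theta> (\<theta> t - s)) \<partial>lborel \<partial>outflow) \<partial>lborel) +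
    (\<integral>\<^sup>+x. indicator \<Omega> x * (\<integral>\<^sup>+s. indicator (einterval 0 (min (tau_minus \<Phi> \<Omega> x) (ereal T))) s * F (\<Phi> x (- s), \<theta> (T - s)) \<partial>lborel) \<partial>\<mu>)"
proof -
  interpret O: sigma_finite_measure outflow by (rule sigma_finite_outflow)
  have [measurable]: "\<theta> \<in> borel_measurable borel" using \<theta> by auto
  have 1: "(\<integral>\<^sup>+t. indicator {0<..<T} t * F (x, \<theta> t) \<partial>lborel) = (\<integral>\<^sup>+t. indicator {0<..<T} t * F (x, t) \<partial>lborel)" for x
    by (rule nn_integral_reflect[OF _ \<theta>]) measurable
  have ind: "indicator (einterval 0 (min (tau_minus \<Phi> \<Omega> y) (ereal t))) s * F (\<Phi> y (- s), \<theta> (t - s)) =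
      (if 0 < s \<and> s < t \<and> ereal s < tau_minus \<Phi> \<Omega> y then F (\<Phi> y (- s), \<theta> (t - s)) else 0)" for y s t
    by (auto simp: einterval_iff indicator_def)
  have 2: "(\<integral>\<^sup>+t. indicator {0<..<T} t * (\<integral>\<^sup>+y. \<integral>\<^sup>+s. indicator (einterval 0 (min (tau_minus \<Phi> \<Omega> y) (ereal (\<theta> t)))) s * F (\<Phi> y (- s), \<theta> (\<theta> t - s)) \<partial>lborel \<partial>outflow) \<partial>lborel)
    = (\<integral>\<^sup>+t. indicator {0<..<T} t * (\<integral>\<^sup>+y. \<integral>\<^sup>+s. indicator (einterval 0 (min (tau_minus \<Phi> \<Omega> y) (ereal t))) s * F (\<Phi> y (- s), \<theta> (t - s)) \<partial>lborel \<partial>outflow) \<partial>lborel)"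
    unfolding ind by (rule nn_integral_reflect[OF _ \<theta>]) measurable
  have "(\<lambda>(x, t). F (x, \<theta> t)) \<in> borel_measurable (borel \<Otimes>\<^sub>M borel)" by measurable
  from outgoing_formula[OF this, of T] show ?thesis by (simp add: 1 2)
qed

lemma outflow_representation:
  assumes \<theta>: "\<theta> = (\<lambda>t. t) \<or> \<theta> = (\<lambda>t. T - t)" and T: "0 < T" and f: "integrable (mu_T \<mu> \<Omega> T) f"
  shows "outgoing_representation \<Phi> \<Omega> \<mu> \<theta> outflow T f"
proof -
  interpret MuL: pair_sigma_finite \<mu> lborel ..
  interpret O: sigma_finite_measure outflow by (rule sigma_finite_outflow)
  interpret OL: pair_sigma_finite outflow lborel ..
  interpret LOL: pair_sigma_finite lborel "outflow \<Otimes>\<^sub>M lborel" ..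
  have [measurable]: "\<theta> \<in> borel_measurable borel" using \<theta> by auto
  have \<theta>_int: "\<theta> t \<in> {0<..<T} \<longleftrightarrow> t \<in> {0<..<T}" for t using \<theta> by auto
  have \<theta>_pos: "0 \<le> \<theta> t" "\<theta> t < T" if "t \<in> {0<..<T}" for t using \<theta> that by auto
  let ?p = "\<lambda>(t, y, s). (\<Phi> y (- s), \<theta> (\<theta> t - s))" and ?q = "\<lambda>(x, s). (\<Phi> x (- s), \<theta> (T - s))"
  let ?b = "\<lambda>t y. min (tau_minus_bd \<Phi> \<Omega> y) (ereal (\<theta> t))" and ?c = "\<lambda>x. min (tau_minus \<Phi> \<Omega> x) (ereal T)"
  let ?B = "{(t, y, s). t \<in> {0<..<T} \<and> y \<in> space outflow \<and> s \<in> einterval 0 (?b t y)}"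
    and ?C = "{(x, s). x \<in> \<Omega> \<and> s \<in> einterval 0 (?c x)}"
  have Y [measurable]: "(\<lambda>z. fst (snd z)) \<in> lborel \<Otimes>\<^sub>M outflow \<Otimes>\<^sub>M lborel \<rightarrow>\<^sub>M borel"
    by measurable
  have b: "0 \<le> ?b t y" if "t \<in> {0<..<T}" "y \<in> space outflow" for t y
    using that \<theta>_pos outgoing_boundary_exit_time_pos[of y] by (simp add: curve_length_outgoing less_imp_le)
  have c: "0 \<le> ?c x" if "x \<in> \<Omega>" for x using T exit_time_nonneg by simp
  have Z: "sets (\<mu> \<Otimes>\<^sub>M lborel) = sets (borel \<Otimes>\<^sub>M borel)"
    by (intro sets_pair_measure_cong) (simp_all add: sets_mu)
  have p [measurable]: "?p \<in> lborel \<Otimes>\<^sub>M outflow \<Otimes>\<^sub>M lborel \<rightarrow>\<^sub>M \<mu> \<Otimes>\<^sub>M lborel"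
  proof -
    have "?p \<in> lborel \<Otimes>\<^sub>M outflow \<Otimes>\<^sub>M lborel \<rightarrow>\<^sub>M borel \<Otimes>\<^sub>M borel"
      unfolding case_prod_unfold by measurable
    then show ?thesis by (simp only: measurable_cong_sets[OF refl Z])
  qed
  have q [measurable]: "?q \<in> \<mu> \<Otimes>\<^sub>M lborel \<rightarrow>\<^sub>M \<mu> \<Otimes>\<^sub>M lborel"
  proof -
    have "?q \<in> borel \<Otimes>\<^sub>M borel \<rightarrow>\<^sub>M borel \<Otimes>\<^sub>M borel"
      unfolding case_prod_unfold by measurable
    then show ?thesis by (simp only: measurable_cong_sets[OF Z Z])
  qed
  have B: "?B \<in> sets (lborel \<Otimes>\<^sub>M outflow \<Otimes>\<^sub>M lborel)"
  proof -
    have "?B = {z \<in> space (lborel \<Otimes>\<^sub>M outflow \<Otimes>\<^sub>M lborel). 0 < fst z \<and> fst z < T \<and> 0 < snd (snd z) \<and>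
        snd (snd z) < \<theta> (fst z) \<and> ereal (snd (snd z)) < tau_minus \<Phi> \<Omega> (fst (snd z))}"
      by (auto simp: space_pair_measure einterval_iff curve_length_outgoing)
    also have "\<dots> \<in> sets (lborel \<Otimes>\<^sub>M outflow \<Otimes>\<^sub>M lborel)" by measurable
    finally show ?thesis .
  qed
  have C: "?C \<in> sets (\<mu> \<Otimes>\<^sub>M lborel)"
  proof -
    have "?C = {z \<in> space (borel \<Otimes>\<^sub>M borel). fst z \<in> \<Omega> \<and> 0 < snd z \<and> snd z < T \<and>
        ereal (snd z) < tau_minus \<Phi> \<Omega> (fst z)}"
      by (auto simp: space_pair_measure einterval_iff)
    also have "\<dots> \<in> sets (borel \<Otimes>\<^sub>M borel)" by measurable
    finally show ?thesis by (simp only: Z)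
  qed
  have pB: "?p ` ?B \<subseteq> \<Omega> \<times> {0<..<T}"
  proof safe
    fix t y s assume a: "t \<in> {0<..<T}" "y \<in> space outflow" "s \<in> einterval 0 (?b t y)"
    then show "\<Phi> y (- s) \<in> \<Omega>"
      using backwards_from_boundary(1)[of y s] by (simp add: einterval_iff curve_length_outgoing)
    have "\<theta> t - s \<in> {0<..<T}" using a \<theta>_pos[OF a(1)] by (auto simp: einterval_iff)
    then show "\<theta> (\<theta> t - s) \<in> {0<..<T}" using \<theta>_int by blast
  qed
  have qC: "?q ` ?C \<subseteq> \<Omega> \<times> {0<..<T}"
  proof safe
    fix x s assume a: "x \<in> \<Omega>" "s \<in> einterval 0 (?c x)"
    then show "\<Phi> x (- s) \<in> \<Omega>"
      using less_exit_time_shift[of s x] by (simp add: einterval_iff)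
    have "T - s \<in> {0<..<T}" using a by (auto simp: einterval_iff)
    then show "\<theta> (T - s) \<in> {0<..<T}" using \<theta>_int by blast
  qed
  have formula: "(\<integral>\<^sup>+z. F z * indicator (\<Omega> \<times> {0<..<T}) z \<partial>(\<mu> \<Otimes>\<^sub>M lborel)) =
      (\<integral>\<^sup>+z. F (?p z) * indicator ?B z \<partial>(lborel \<Otimes>\<^sub>M outflow \<Otimes>\<^sub>M lborel)) +
      (\<integral>\<^sup>+z. F (?q z) * indicator ?C z \<partial>(\<mu> \<Otimes>\<^sub>M lborel))"
    if F: "F \<in> borel_measurable (\<mu> \<Otimes>\<^sub>M lborel)" for F :: "'a \<times> real \<Rightarrow> ennreal"
  proof -
    note [measurable] = F B C
    have F' [measurable]: "F \<in> borel_measurable (borel \<Otimes>\<^sub>M borel)"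
      using F by (simp only: measurable_cong_sets[OF Z refl])
    define U where "U z = F (?p z) * indicator ?B z" for z
    define W where "W z = F (?q z) * indicator ?C z" for z
    have U: "U \<in> borel_measurable (lborel \<Otimes>\<^sub>M outflow \<Otimes>\<^sub>M lborel)"
      unfolding U_def by (intro borel_measurable_times_ennreal measurable_compose[OF p F] borel_measurable_indicator B)
    have W: "W \<in> borel_measurable (\<mu> \<Otimes>\<^sub>M lborel)"
      unfolding W_def by (intro borel_measurable_times_ennreal measurable_compose[OF q F] borel_measurable_indicator C)
    have D [measurable]: "\<Omega> \<times> {0<..<T} \<in> sets (\<mu> \<Otimes>\<^sub>M lborel)" by (intro pair_measureI) (simp_all add: sets_mu)
    have "(\<integral>\<^sup>+z. F z * indicator (\<Omega> \<times> {0<..<T}) z \<partial>(\<mu> \<Otimes>\<^sub>M lborel)) =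
        (\<integral>\<^sup>+x. \<integral>\<^sup>+t. F (x, t) * indicator (\<Omega> \<times> {0<..<T}) (x, t) \<partial>lborel \<partial>\<mu>)"
      by (rule lborel.nn_integral_fst[symmetric]) measurable
    also have "\<dots> = (\<integral>\<^sup>+x. indicator \<Omega> x * (\<integral>\<^sup>+t. indicator {0<..<T} t * F (x, t) \<partial>lborel) \<partial>\<mu>)"
    proof (rule nn_integral_cong)
      fix x
      show "(\<integral>\<^sup>+t. F (x, t) * indicator (\<Omega> \<times> {0<..<T}) (x, t) \<partial>lborel) =
          indicator \<Omega> x * (\<integral>\<^sup>+t. indicator {0<..<T} t * F (x, t) \<partial>lborel)"
        by (cases "x \<in> \<Omega>") (auto simp: indicator_times mult.commute)
    qed
    also note outgoing_formula_time_reversal[OF F' \<theta>]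
    also have "(\<integral>\<^sup>+t. indicator {0<..<T} t * (\<integral>\<^sup>+y. \<integral>\<^sup>+s. indicator (einterval 0 (min (tau_minus \<Phi> \<Omega> y) (ereal (\<theta> t)))) s * F (\<Phi> y (- s), \<theta> (\<theta> t - s)) \<partial>lborel \<partial>outflow) \<partial>lborel) =
        (\<integral>\<^sup>+t. \<integral>\<^sup>+y. \<integral>\<^sup>+s. F (?p (t, y, s)) * indicator ?B (t, y, s) \<partial>lborel \<partial>outflow \<partial>lborel)"
    proof (rule nn_integral_cong)
      fix t
      have *: "F (?p (t, y, s)) * indicator ?B (t, y, s) = indicator {0<..<T} t *
          (indicator (einterval 0 (min (tau_minus \<Phi> \<Omega> y) (ereal (\<theta> t)))) s * F (\<Phi> y (- s), \<theta> (\<theta> t - s)))"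
        if "y \<in> space outflow" for y s
        using that by (auto simp: curve_length_outgoing indicator_def)
      have "(\<integral>\<^sup>+y. \<integral>\<^sup>+s. F (?p (t, y, s)) * indicator ?B (t, y, s) \<partial>lborel \<partial>outflow) =
        (\<integral>\<^sup>+y. \<integral>\<^sup>+s. indicator {0<..<T} t *
          (indicator (einterval 0 (min (tau_minus \<Phi> \<Omega> y) (ereal (\<theta> t)))) s * F (\<Phi> y (- s), \<theta> (\<theta> t - s))) \<partial>lborel \<partial>outflow)"
        by (intro nn_integral_cong *)
      then show "indicator {0<..<T} t * (\<integral>\<^sup>+y. \<integral>\<^sup>+s. indicator (einterval 0 (min (tau_minus \<Phi> \<Omega> y) (ereal (\<theta> t)))) s * F (\<Phi> y (- s), \<theta> (\<theta> t - s)) \<partial>lborel \<partial>outflow) =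
        (\<integral>\<^sup>+y. \<integral>\<^sup>+s. F (?p (t, y, s)) * indicator ?B (t, y, s) \<partial>lborel \<partial>outflow)"
        by (cases "t \<in> {0<..<T}") simp_all
    qed
    also have "\<dots> = (\<integral>\<^sup>+t. \<integral>\<^sup>+z. U (t, z) \<partial>(outflow \<Otimes>\<^sub>M lborel) \<partial>lborel)"
    proof (rule nn_integral_cong)
      fix t :: real assume "t \<in> space lborel"
      from lborel.nn_integral_fst[OF measurable_compose_Pair1[OF this U]]
      show "(\<integral>\<^sup>+y. \<integral>\<^sup>+s. F (?p (t, y, s)) * indicator ?B (t, y, s) \<partial>lborel \<partial>outflow) =
          (\<integral>\<^sup>+z. U (t, z) \<partial>(outflow \<Otimes>\<^sub>M lborel))"
        by (simp only: U_def)
    qed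
    also have "\<dots> = integral\<^sup>N (lborel \<Otimes>\<^sub>M outflow \<Otimes>\<^sub>M lborel) U"
      by (rule OL.nn_integral_fst[OF U])
    also have "(\<integral>\<^sup>+x. indicator \<Omega> x * (\<integral>\<^sup>+s. indicator (einterval 0 (?c x)) s * F (\<Phi> x (- s), \<theta> (T - s)) \<partial>lborel) \<partial>\<mu>) =
        (\<integral>\<^sup>+x. \<integral>\<^sup>+s. F (?q (x, s)) * indicator ?C (x, s) \<partial>lborel \<partial>\<mu>)"
    proof (rule nn_integral_cong)
      fix x
      show "indicator \<Omega> x * (\<integral>\<^sup>+s. indicator (einterval 0 (?c x)) s * F (\<Phi> x (- s), \<theta> (T - s)) \<partial>lborel) =
          (\<integral>\<^sup>+s. F (?q (x, s)) * indicator ?C (x, s) \<partial>lborel)"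
        by (cases "x \<in> \<Omega>") (auto simp: indicator_def intro!: nn_integral_cong)
    qed
    also have "\<dots> = integral\<^sup>N (\<mu> \<Otimes>\<^sub>M lborel) W"
      using lborel.nn_integral_fst[OF W] by (simp only: W_def)
    finally show ?thesis by (simp only: U_def[abs_def] W_def[abs_def])
  qed
  have \<Omega>: "\<Omega> \<in> sets \<mu>" by (simp add: sets_mu)
  \<comment> \<open>The order is that of the hypotheses of the transfer lemmas.\<close>
  note args = sigma_finite_measure_axioms sigma_finite_outflow T \<Omega> b c p q B C pB qC formula f
  show ?thesis
    unfolding outgoing_representation_def
    by (intro conjI boundary_integral_exists_transfer[OF args, unfolded prod.case]
        interior_integral_exists_transfer[OF args, unfolded prod.case] integral_transfer[OF args, unfolded prod.case])
qed

end

section \<open>Uniqueness\<close>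

context invariant_flow
begin

text \<open>
  The inner integral of the boundary term for an integrand that does not depend on time.
\<close>

definition arc_integral :: "('a \<Rightarrow> real) \<Rightarrow> real \<Rightarrow> 'a \<Rightarrow> ennreal" where
  "arc_integral h t y = (\<integral>\<^sup>+s. indicator (einterval 0 (min (tau_minus \<Phi> \<Omega> y) (ereal t))) s * ennreal (h (\<Phi> y (- s))) \<partial>lborel)"

lemma arc_measurable:
  assumes [measurable]: "h \<in> borel_measurable borel" "f \<in> borel_measurable M" "g \<in> borel_measurable M"
  shows "(\<lambda>z. arc_integral h (g z) (f z)) \<in> borel_measurable M"
proof -
  have "indicator (einterval 0 (min (tau_minus \<Phi> \<Omega> y) (ereal t))) s * ennreal (h (\<Phi> y (- s))) =
      (if 0 < s \<and> s < t \<and> ereal s < tau_minus \<Phi> \<Omega> y then ennreal (h (\<Phi> y (- s))) else 0)" for y s t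
    by (auto simp: einterval_iff indicator_def)
  then show ?thesis unfolding arc_integral_def by simp
qed

lemma arc_bounds:
  assumes [measurable]: "h \<in> borel_measurable borel" and h: "\<And>x. 0 < h x" "\<And>x. h x \<le> 1"
    and t: "0 < t" "t < 1" and y: "y \<in> Gamma_plus \<Phi> \<Omega>"
  shows "0 < arc_integral h t y" "arc_integral h t y \<le> 1"
proof -
  show "0 < arc_integral h t y"
    unfolding arc_integral_def
  proof (rule nn_integral_einterval_pos)
    show "0 < min (tau_minus \<Phi> \<Omega> y) (ereal t)" using t outgoing_boundary_exit_time_pos[OF y] by simp
  qed (use h in auto)
  have "arc_integral h t y \<le> (\<integral>\<^sup>+s. indicator {0..1::real} s \<partial>lborel)"
    unfolding arc_integral_def using h t by (intro nn_integral_mono) (auto simp: indicator_def einterval_iff ennreal_le_1)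
  then show "arc_integral h t y \<le> 1" by simp
qed

text \<open>
  The point is that the right-hand side does not involve \<open>P\<close>. The test function \<open>f A\<close> is constant in
  time and vanishes on all trajectories except those that exit through \<open>A\<close>. So the boundary term of its
  representation is, up to the order of integration, the left-hand side. Tonelli's theorem needs \<open>P\<close>
  to be \<open>\<sigma>\<close>-finite. That is a consequence of the existence of the integrals for \<open>f (space P)\<close>:
  for some \<open>t\<close>, the positive function \<open>arc_integral h (\<theta> t)\<close> is integrable.
\<close>

lemma outflow_determined:
  fixes h :: "'a \<Rightarrow> real"
  assumes h [measurable]: "h \<in> borel_measurable borel" and h_pos: "\<And>x. 0 < h x" and h_le: "\<And>x. h x \<le> 1"
    and h_fin: "(\<integral>\<^sup>+x. ennreal (h x) \<partial>\<mu>) < \<infinity>"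
    and \<theta>: "\<theta> = (\<lambda>t. t) \<or> \<theta> = (\<lambda>t. 1 - t)"
    and P: "borel_measure_on (Gamma_plus \<Phi> \<Omega>) P"
    and rep: "\<And>f. integrable (mu_T \<mu> \<Omega> 1) f \<Longrightarrow> outgoing_representation \<Phi> \<Omega> \<mu> \<theta> P 1 f"
    and A: "A \<in> sets P"
  defines "f \<equiv> \<lambda>A (z :: 'a \<times> real). if fst z \<in> escaping \<and> exit_point (fst z) \<in> A then h (fst z) else 0"
  shows "(\<integral>\<^sup>+y. indicator A y * (\<integral>\<^sup>+t. indicator {0<..<1} t * arc_integral h (\<theta> t) y \<partial>lborel) \<partial>P) =
    ennreal ((LINT z|mu_T \<mu> \<Omega> 1. f A z) - (LINT x:\<Omega>|completion \<mu>.
      (LINT s=0..min (tau_minus \<Phi> \<Omega> x) (ereal 1)|lebesgue. f A (\<Phi> x (- s), \<theta> (1 - s)))))"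
proof -
  let ?G = "Gamma_plus \<Phi> \<Omega>"
  have sp: "space P = ?G" and setsP: "sets P = sets (restrict_space borel ?G)"
    using P by (auto simp: borel_measure_on_def)
  have [measurable]: "(\<lambda>y. y) \<in> P \<rightarrow>\<^sub>M borel"
    using measurable_restrict_space1[OF measurable_ident, of borel "?G"]
    by (simp add: id_def measurable_cong_sets[OF setsP refl])
  have \<theta>m [measurable]: "\<theta> \<in> borel_measurable borel" using \<theta> by auto
  have \<theta>_int: "0 < \<theta> t" "\<theta> t < 1" if "t \<in> {0<..<1}" for t using \<theta> that by auto
  note [measurable] = arc_measurable
  have Gs: "?G \<in> sets P" using sets.top[of P] sp by simp
  have borel: "B \<in> sets borel" if "B \<in> sets P" for B
    using that by (auto simp: setsP sets_restrict_space)
  have sub: "B \<subseteq> ?G" if "B \<in> sets P" for B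
    using sets.sets_into_space[OF that] sp by simp
  have f_integrable: "integrable (mu_T \<mu> \<Omega> 1) (f B)" if B: "B \<in> sets P" for B
  proof -
    have [measurable]: "B \<in> sets borel" using borel[OF B] .
    let ?Z = "\<mu> \<Otimes>\<^sub>M (lborel :: real measure)"
    have Z: "sets ?Z = sets (borel \<Otimes>\<^sub>M borel)"
      by (intro sets_pair_measure_cong) (simp_all add: sets_mu)
    have D: "\<Omega> \<times> {0<..<1::real} \<in> sets ?Z" by (intro pair_measureI) (simp_all add: sets_mu)
    have fm: "f B \<in> borel_measurable (borel \<Otimes>\<^sub>M borel)" unfolding f_def by measurable
    then have fm' [measurable]: "f B \<in> borel_measurable ?Z" by (simp only: measurable_cong_sets[OF Z refl])
    let ?u = "\<lambda>z. indicator (\<Omega> \<times> {0<..<1}) z *\<^sub>R f B z"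
    have um: "?u \<in> borel_measurable ?Z" using D by measurable
    have "(\<integral>\<^sup>+z. ennreal (norm (?u z)) \<partial>?Z) \<le> (\<integral>\<^sup>+z. ennreal (h (fst z)) * indicator {0<..<1} (snd z) \<partial>?Z)"
      using h_pos by (intro nn_integral_mono) (auto simp: f_def indicator_def less_imp_le)
    also have "\<dots> = (\<integral>\<^sup>+x. \<integral>\<^sup>+t. ennreal (h x) * indicator {0<..<1::real} t \<partial>lborel \<partial>\<mu>)"
      by (subst lborel.nn_integral_fst[symmetric]) (auto simp: measurable_cong_sets[OF Z refl])
    also have "\<dots> = (\<integral>\<^sup>+x. ennreal (h x) \<partial>\<mu>)"
      by (intro nn_integral_cong) (simp add: nn_integral_cmult)
    also have "\<dots> < \<infinity>" by (rule h_fin)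
    finally have "integrable ?Z ?u" using um by (intro integrableI_bounded) auto
    then have "integrable (completion ?Z) ?u" by (simp only: integrable_completion[OF um])
    then show ?thesis
      unfolding mu_T_def using D by (subst integrable_restrict_space) auto
  qed
  let ?J = "\<lambda>B t y. LINT s=0..min (tau_minus_bd \<Phi> \<Omega> y) (ereal (\<theta> t))|lebesgue. f B (\<Phi> y (- s), \<theta> (\<theta> t - s))"
  have J: "?J B t y = enn2real (indicator B y * arc_integral h (\<theta> t) y)"
    if B: "B \<in> sets P" and t: "t \<in> {0<..<1}" and y: "y \<in> ?G" for B t y
  proof -
    let ?b = "min (tau_minus \<Phi> \<Omega> y) (ereal (\<theta> t))"
    define G where "G s = indicator B y * (indicator (einterval 0 ?b) s * h (\<Phi> y (- s)))" for s
    have G_m: "G \<in> borel_measurable borel" unfolding G_def by measurable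
    have b: "0 \<le> ?b" using \<theta>_int(1)[OF t] outgoing_boundary_exit_time_pos[OF y] by (simp add: less_imp_le)
    have "G s = indicator (einterval 0 ?b) s * f B (\<Phi> y (- s), \<theta> (\<theta> t - s))" for s
      using backwards_escaping[OF y, of s] by (auto simp: G_def f_def indicator_def einterval_iff)
    then have "?J B t y = integral\<^sup>L lborel G"
      unfolding curve_length_outgoing[OF y] by (intro interval_lebesgue_integral_cong_AE[OF b G_m]) simp
    also have "\<dots> = enn2real (\<integral>\<^sup>+s. ennreal (G s) \<partial>lborel)"
      using G_m h_pos by (intro integral_eq_nn_integral) (auto simp: G_def less_imp_le)
    also have "(\<integral>\<^sup>+s. ennreal (G s) \<partial>lborel) = (\<integral>\<^sup>+s. indicator B y *
        (indicator (einterval 0 ?b) s * ennreal (h (\<Phi> y (- s)))) \<partial>lborel)"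
      by (intro nn_integral_cong) (auto simp: G_def indicator_def)
    also have "\<dots> = indicator B y * arc_integral h (\<theta> t) y"
      unfolding arc_integral_def by (rule nn_integral_cmult) measurable
    finally show ?thesis .
  qed
  \<comment> \<open>Boundedness of \<open>h\<close> keeps the arc integrals finite, where \<open>enn2real\<close> is faithful.\<close>
  have arc_fin: "ennreal (enn2real (indicator B y * arc_integral h (\<theta> t) y)) = indicator B y * arc_integral h (\<theta> t) y"
    if "t \<in> {0<..<1}" "y \<in> ?G" for B t y
    using arc_bounds(2)[OF h h_pos h_le \<theta>_int[OF that(1)] that(2)]
    by (intro ennreal_enn2real) (auto simp: indicator_def intro: le_less_trans)
  have inner: "AE t in lborel. t \<in> {0<..<1} \<longrightarrow> 0 \<le> (LINT y|completion P. ?J B t y) \<and>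
      (\<integral>\<^sup>+y. indicator B y * arc_integral h (\<theta> t) y \<partial>P) = ennreal (LINT y|completion P. ?J B t y)"
    if B: "B \<in> sets P" for B
  proof -
    have "AE t in lebesgue. t \<in> {0<..<1} \<longrightarrow> integrable (completion P) (?J B t)"
      using rep[OF f_integrable[OF B]]
      unfolding outgoing_representation_def boundary_integral_exists_def by (auto elim!: eventually_mono)
    then have "AE t in lborel. t \<in> {0<..<1} \<longrightarrow> integrable (completion P) (?J B t)"
      by (simp add: AE_completion_iff)
    then show ?thesis
    proof eventually_elim
      fix t assume int: "t \<in> {0<..<1} \<longrightarrow> integrable (completion P) (?J B t)"
      show "t \<in> {0<..<1} \<longrightarrow> 0 \<le> (LINT y|completion P. ?J B t y) \<and>
          (\<integral>\<^sup>+y. indicator B y * arc_integral h (\<theta> t) y \<partial>P) = ennreal (LINT y|completion P. ?J B t y)"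
      proof (intro impI conjI)
        assume t: "t \<in> {0<..<1}"
        have J0: "0 \<le> ?J B t y" if "y \<in> space (completion P)" for y
          using J[OF B t, of y] that sp by simp
        then show "0 \<le> (LINT y|completion P. ?J B t y)" by (rule Bochner_Integration.integral_nonneg)
        have "ennreal (LINT y|completion P. ?J B t y) = (\<integral>\<^sup>+y. ennreal (?J B t y) \<partial>completion P)"
          using int t J0 by (intro nn_integral_eq_integral[symmetric]) auto
        also have "\<dots> = (\<integral>\<^sup>+y. indicator B y * arc_integral h (\<theta> t) y \<partial>P)"
          unfolding nn_integral_completion
          by (intro nn_integral_cong) (simp add: J[OF B t] arc_fin[OF t] sp)
        finally show "(\<integral>\<^sup>+y. indicator B y * arc_integral h (\<theta> t) y \<partial>P) = ennreal (LINT y|completion P. ?J B t y)" ..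
      qed
    qed
  qed
  have "sigma_finite_measure P"
  proof -
    obtain t where t: "t \<in> {0<..<1}" "(\<integral>\<^sup>+y. indicator ?G y * arc_integral h (\<theta> t) y \<partial>P) = ennreal (LINT y|completion P. ?J ?G t y)"
      using AE_lborel_interval_witness[OF inner[OF Gs]] by auto
    have "(\<integral>\<^sup>+y. arc_integral h (\<theta> t) y \<partial>P) = (\<integral>\<^sup>+y. indicator ?G y * arc_integral h (\<theta> t) y \<partial>P)"
      by (intro nn_integral_cong) (simp add: sp)
    then have "(\<integral>\<^sup>+y. arc_integral h (\<theta> t) y \<partial>P) < \<infinity>" using t(2) by simp
    then show ?thesis
      using arc_bounds(1)[OF h h_pos h_le \<theta>_int[OF t(1)]] sp
      by (intro sigma_finite_measureI_positive_integrable[of "arc_integral h (\<theta> t)"]) auto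
  qed
  then interpret P: sigma_finite_measure P .
  interpret PL: pair_sigma_finite P lborel ..
  let ?L = "\<lambda>t. LINT y|completion P. ?J A t y"
  have "(\<integral>\<^sup>+y. indicator A y * (\<integral>\<^sup>+t. indicator {0<..<1} t * arc_integral h (\<theta> t) y \<partial>lborel) \<partial>P) =
      (\<integral>\<^sup>+y. \<integral>\<^sup>+t. indicator A y * (indicator {0<..<1} t * arc_integral h (\<theta> t) y) \<partial>lborel \<partial>P)"
    by (intro nn_integral_cong nn_integral_cmult[symmetric]) measurable
  also have "\<dots> = (\<integral>\<^sup>+t. \<integral>\<^sup>+y. indicator A y * (indicator {0<..<1} t * arc_integral h (\<theta> t) y) \<partial>P \<partial>lborel)"
  proof (rule PL.Fubini'[symmetric])
    note [measurable] = A
    have [measurable]: "(\<lambda>z. arc_integral h (\<theta> (snd z)) (fst z)) \<in> borel_measurable (P \<Otimes>\<^sub>M lborel)"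
      by (rule arc_measurable[OF h]) measurable
    show "(\<lambda>(y, t). indicator A y * (indicator {0<..<1} t * arc_integral h (\<theta> t) y))
        \<in> borel_measurable (P \<Otimes>\<^sub>M lborel)"
      unfolding case_prod_unfold by measurable
  qed
  also have "\<dots> = (\<integral>\<^sup>+t. indicator {0<..<1} t * (\<integral>\<^sup>+y. indicator A y * arc_integral h (\<theta> t) y \<partial>P) \<partial>lborel)"
    using A by (intro nn_integral_cong) (simp add: nn_integral_cmult[symmetric] ac_simps)
  also have "\<dots> = (\<integral>\<^sup>+t. ennreal (indicator {0<..<1} t * ?L t) \<partial>lborel)"
    using inner[OF A] by (intro nn_integral_cong_AE) (auto elim!: eventually_mono simp: indicator_def)
  also have "\<dots> = (\<integral>\<^sup>+t. ennreal (indicator {0<..<1} t * ?L t) \<partial>lebesgue)"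
    by (simp add: nn_integral_completion)
  also have "\<dots> = ennreal (LINT t|lebesgue. indicator {0<..<1} t * ?L t)"
  proof (rule nn_integral_eq_integral)
    have "interval_lebesgue_integrable lebesgue 0 (ereal 1) ?L"
      using rep[OF f_integrable[OF A]]
      unfolding outgoing_representation_def boundary_integral_exists_def by blast
    moreover have "einterval 0 (ereal 1) = {0<..<1}" by (auto simp: einterval_iff)
    ultimately show "integrable lebesgue (\<lambda>t. indicator {0<..<1} t * ?L t)"
      by (simp add: interval_lebesgue_integrable_def set_integrable_def)
    show "AE t in lebesgue. 0 \<le> indicator {0<..<1} t * ?L t"
      using AE_completion[OF inner[OF A]] by (auto elim!: eventually_mono simp: indicator_def)
  qed
  also have "(LINT t|lebesgue. indicator {0<..<1} t * ?L t) = (LINT t=0..ereal 1|lebesgue. ?L t)"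
  proof -
    have "einterval 0 (ereal 1) = {0<..<1}" by (auto simp: einterval_iff)
    then show ?thesis by (simp add: interval_lebesgue_integral_def set_lebesgue_integral_def)
  qed
  also have "\<dots> = (LINT z|mu_T \<mu> \<Omega> 1. f A z) - (LINT x:\<Omega>|completion \<mu>.
      (LINT s=0..min (tau_minus \<Phi> \<Omega> x) (ereal 1)|lebesgue. f A (\<Phi> x (- s), \<theta> (1 - s))))"
    using rep[OF f_integrable[OF A]] unfolding outgoing_representation_def by simp
  finally show ?thesis .
qed

text \<open>
  The positive bounded function \<open>k\<close> is the same for both measures, so \<open>outflow_determined\<close> says that
  \<open>k \<cdot> P = k \<cdot> Q\<close>.
\<close>

lemma outflow_unique:
  assumes \<theta>: "\<theta> = (\<lambda>t. t) \<or> \<theta> = (\<lambda>t. 1 - t)"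
    and P: "borel_measure_on (Gamma_plus \<Phi> \<Omega>) P" "\<And>f. integrable (mu_T \<mu> \<Omega> 1) f \<Longrightarrow> outgoing_representation \<Phi> \<Omega> \<mu> \<theta> P 1 f"
    and Q: "borel_measure_on (Gamma_plus \<Phi> \<Omega>) Q" "\<And>f. integrable (mu_T \<mu> \<Omega> 1) f \<Longrightarrow> outgoing_representation \<Phi> \<Omega> \<mu> \<theta> Q 1 f"
  shows "P = Q"
proof -
  obtain h0 where h0 [measurable]: "h0 \<in> borel_measurable \<mu>"
    and fin: "integral\<^sup>N \<mu> h0 \<noteq> \<infinity>" and pos: "\<And>x. x \<in> space \<mu> \<Longrightarrow> 0 < h0 x \<and> h0 x < \<infinity>"
    using Ex_finite_integrable_function by blast
  have sp: "space \<mu> = UNIV" using sets_eq_imp_space_eq[OF sets_mu] by simp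
  have h0' [measurable]: "h0 \<in> borel_measurable borel" using h0 by (simp add: measurable_cong_sets[OF sets_mu refl])
  \<comment> \<open>The truncation bounds all arc integrals by \<open>1\<close>.\<close>
  define h where "h x = enn2real (min 1 (h0 x))" for x
  have h [measurable]: "h \<in> borel_measurable borel" unfolding h_def by measurable
  have h_pos: "0 < h x" and h_le: "h x \<le> 1" for x
    using pos[of x] sp by (auto simp: h_def enn2real_positive_iff min_def enn2real_leI)
  have "(\<integral>\<^sup>+x. ennreal (h x) \<partial>\<mu>) \<le> integral\<^sup>N \<mu> h0"
  proof (rule nn_integral_mono)
    fix x
    have "ennreal (h x) = min 1 (h0 x)"
      unfolding h_def by (rule ennreal_enn2real) (simp add: min_less_iff_disj)
    then show "ennreal (h x) \<le> h0 x" by simp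
  qed
  then have h_fin: "(\<integral>\<^sup>+x. ennreal (h x) \<partial>\<mu>) < \<infinity>" using fin by (simp add: less_top le_less_trans)
  have setsP: "sets P = sets (restrict_space borel (Gamma_plus \<Phi> \<Omega>))" "space P = Gamma_plus \<Phi> \<Omega>"
    and setsQ: "sets Q = sets (restrict_space borel (Gamma_plus \<Phi> \<Omega>))"
    using P(1) Q(1) by (auto simp: borel_measure_on_def)
  have [measurable]: "(\<lambda>y. y) \<in> P \<rightarrow>\<^sub>M borel"
    using measurable_restrict_space1[OF measurable_ident, of borel "Gamma_plus \<Phi> \<Omega>"]
    by (simp add: id_def measurable_cong_sets[OF setsP(1) refl])
  have [measurable]: "\<theta> \<in> borel_measurable borel" using \<theta> by auto
  have \<theta>_int: "0 < \<theta> t" "\<theta> t < 1" if "t \<in> {0<..<1}" for t using \<theta> that by auto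
  note [measurable] = arc_measurable
  define k where "k y = (\<integral>\<^sup>+t. indicator {0<..<1} t * arc_integral h (\<theta> t) y \<partial>lborel)" for y
  have ein: "einterval 0 (ereal 1) = {0<..<1}" by (auto simp: einterval_iff)
  show ?thesis
  proof (rule density_inj)
    show "sets P = sets Q" using setsP setsQ by simp
    show "k \<in> borel_measurable P" unfolding k_def by measurable
    show "0 < k y \<and> k y < \<infinity>" if "y \<in> space P" for y
    proof
      have y: "y \<in> Gamma_plus \<Phi> \<Omega>" using that setsP by simp
      note b = arc_bounds[OF h h_pos h_le \<theta>_int y]
      show "0 < k y"
        unfolding k_def ein[symmetric]
        by (rule nn_integral_einterval_pos) (auto simp: ein b)
      have "k y \<le> (\<integral>\<^sup>+t. indicator {0<..<1::real} t \<partial>lborel)"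
        unfolding k_def using b(2) by (intro nn_integral_mono) (auto simp: indicator_def)
      then show "k y < \<infinity>" by (auto intro: le_less_trans)
    qed
    show "(\<integral>\<^sup>+y. indicator A y * k y \<partial>P) = (\<integral>\<^sup>+y. indicator A y * k y \<partial>Q)" if "A \<in> sets P" for A
      using outflow_determined[OF h h_pos h_le h_fin \<theta> P that]
        outflow_determined[OF h h_pos h_le h_fin \<theta> Q, of A] that setsP(1) setsQ
      unfolding k_def by simp
  qed
qed

lemma borel_measure_on_outflow: "borel_measure_on (Gamma_plus \<Phi> \<Omega>) outflow"
  by (simp add: borel_measure_on_def sets_outflow)

end

section \<open>The boundary measures of a Lipschitz flow\<close>

text \<open>
  The theorem sees \<open>\<mu>\<close> only through completions, so \<open>\<mu>\<close> may be replaced by a measure on the Borel sets.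
\<close>

lemma radon_measure_borel_part:
  fixes \<mu> :: "'a::euclidean_space measure"
  assumes "radon_measure \<mu>"
  obtains \<nu> where "sets \<nu> = sets borel" "sigma_finite_measure \<nu>" "completion \<mu> = completion \<nu>"
    "completion (\<mu> \<Otimes>\<^sub>M lborel) = completion (\<nu> \<Otimes>\<^sub>M (lborel :: real measure))"
    "\<And>A. A \<in> sets borel \<Longrightarrow> A \<in> sets \<mu> \<and> emeasure \<mu> A = emeasure \<nu> A"
proof -
  obtain \<nu> where \<nu>: "sets \<nu> = sets borel" "\<mu> = \<nu> \<or> \<mu> = completion \<nu>"
    using assms unfolding radon_measure_def by blast
  have eq: "A \<in> sets \<mu> \<and> emeasure \<mu> A = emeasure \<nu> A" if "A \<in> sets borel" for A
    using \<nu> that by auto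
  have fin: "emeasure \<nu> K < \<infinity>" if "compact K" for K
    using assms eq[of K] that by (auto simp: radon_measure_def borel_compact)
  have "sigma_finite_measure \<nu>"
  proof
    have "(\<Union>n. cball 0 (real n)) = (UNIV :: 'a set)"
      by (auto simp: real_arch_simple)
    then show "\<exists>A. countable A \<and> A \<subseteq> sets \<nu> \<and> \<Union>A = space \<nu> \<and> (\<forall>a\<in>A. emeasure \<nu> a \<noteq> \<infinity>)"
      using fin[OF compact_cball] sets_eq_imp_space_eq[OF \<nu>(1)] \<nu>(1)
      by (intro exI[of _ "range (\<lambda>n. cball 0 (real n))"]) (auto simp: less_top[symmetric])
  qed
  then show ?thesis
    using \<nu> eq completion_completion[of \<nu>]
      completion_pair_completion[OF lborel.sigma_finite_measure_axioms, of \<nu>]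
    by (intro that[of \<nu>]) auto
qed

lemma invariant_flowI:
  assumes "flow_domain \<Phi> \<Omega>" and inv: "flow_invariant \<mu> \<Phi>" and \<nu>: "sets \<nu> = sets borel" "sigma_finite_measure \<nu>"
    and eq: "\<And>A. A \<in> sets borel \<Longrightarrow> A \<in> sets \<mu> \<and> emeasure \<mu> A = emeasure \<nu> A"
  shows "invariant_flow \<Phi> \<Omega> \<nu>"
proof -
  interpret flow_domain \<Phi> \<Omega> by fact
  interpret sigma_finite_measure \<nu> by fact
  show ?thesis
  proof
    show "distr \<nu> borel (\<lambda>x. \<Phi> x t) = \<nu>" for t
    proof (rule measure_eqI)
      fix A assume "A \<in> sets (distr \<nu> borel (\<lambda>x. \<Phi> x t))"
      then have A [measurable]: "A \<in> sets borel" by simp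
      have m: "(\<lambda>x. \<Phi> x t) \<in> borel_measurable \<nu>" by (simp add: measurable_cong_sets[OF \<nu>(1) refl])
      have img: "(\<lambda>x. \<Phi> x t) -` A = (\<lambda>x. \<Phi> x (- t)) ` A"
      proof (intro set_eqI iffI)
        fix x assume "x \<in> (\<lambda>x. \<Phi> x t) -` A"
        then show "x \<in> (\<lambda>x. \<Phi> x (- t)) ` A" by (intro image_eqI[of _ _ "\<Phi> x t"]) auto
      qed auto
      have B: "(\<lambda>x. \<Phi> x t) -` A \<in> sets borel" using measurable_sets_borel[of "\<lambda>x. \<Phi> x t" borel A] by simp
      have "emeasure (distr \<nu> borel (\<lambda>x. \<Phi> x t)) A = emeasure \<nu> ((\<lambda>x. \<Phi> x t) -` A)"
        using m sets_eq_imp_space_eq[OF \<nu>(1)] by (simp add: emeasure_distr)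
      also have "\<dots> = emeasure \<mu> ((\<lambda>x. \<Phi> x (- t)) ` A)" using eq[OF B] img by simp
      also have "\<dots> = emeasure \<nu> A"
        using inv eq[OF A] by (auto simp: flow_invariant_def)
      finally show "emeasure (distr \<nu> borel (\<lambda>x. \<Phi> x t)) A = emeasure \<nu> A" .
    qed (simp add: \<nu>)
  qed fact
qed

theorem lemma2p9:
  fixes \<mu> :: "(real ^ 'n) measure"
    and F :: "real ^ 'n \<Rightarrow> real ^ 'n"
    and \<Phi> :: "real ^ 'n \<Rightarrow> real \<Rightarrow> real ^ 'n"
    and \<Omega> :: "(real ^ 'n) set"
  assumes "radon_measure \<mu>"
    and "\<exists>L. L-lipschitz_on UNIV F"
    and "global_flow F \<Phi>"
    and "flow_invariant \<mu> \<Phi>"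
    and "open \<Omega>"
  shows "\<exists>!(\<mu>p, \<mu>m).
    borel_measure_on (Gamma_plus \<Phi> \<Omega>) \<mu>p \<and>
    borel_measure_on (Gamma_minus \<Phi> \<Omega>) \<mu>m \<and>
    (\<forall>T::real. 0 < T \<longrightarrow> (\<forall>f :: (real ^ 'n) \<times> real \<Rightarrow> real. integrable (mu_T \<mu> \<Omega> T) f \<longrightarrow>
      boundary_integral_exists T \<mu>p
        (\<lambda>t y. min (tau_minus_bd \<Phi> \<Omega> y) (ereal t)) (\<lambda>t y s. f (\<Phi> y (- s), t - s)) \<and>
      interior_integral_exists \<Omega> \<mu>
        (\<lambda>x. min (tau_minus \<Phi> \<Omega> x) (ereal T)) (\<lambda>x s. f (\<Phi> x (- s), T - s)) \<and>
      (LINT z|mu_T \<mu> \<Omega> T. f z) =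
        (LINT t=0..ereal T|lebesgue. (LINT y|completion \<mu>p.
           (LINT s=0..min (tau_minus_bd \<Phi> \<Omega> y) (ereal t)|lebesgue. f (\<Phi> y (- s), t - s)))) +
        (LINT x:\<Omega>|completion \<mu>.
           (LINT s=0..min (tau_minus \<Phi> \<Omega> x) (ereal T)|lebesgue. f (\<Phi> x (- s), T - s))) \<and>
      boundary_integral_exists T \<mu>m
        (\<lambda>t y. min (tau_plus_bd \<Phi> \<Omega> y) (ereal (T - t))) (\<lambda>t y s. f (\<Phi> y s, t + s)) \<and>
      interior_integral_exists \<Omega> \<mu>
        (\<lambda>x. min (tau_plus \<Phi> \<Omega> x) (ereal T)) (\<lambda>x s. f (\<Phi> x s, s)) \<and>
      (LINT z|mu_T \<mu> \<Omega> T. f z) =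
        (LINT t=0..ereal T|lebesgue. (LINT y|completion \<mu>m.
           (LINT s=0..min (tau_plus_bd \<Phi> \<Omega> y) (ereal (T - t))|lebesgue. f (\<Phi> y s, t + s)))) +
        (LINT x:\<Omega>|completion \<mu>.
           (LINT s=0..min (tau_plus \<Phi> \<Omega> x) (ereal T)|lebesgue. f (\<Phi> x s, s)))))"
proof -
  obtain L where "L-lipschitz_on UNIV F" using assms(2) by blast
  then have fd: "flow_domain \<Phi> \<Omega>" using assms(3,5) by (rule flow_domain_lipschitz)
  obtain \<nu> where \<nu>: "sets \<nu> = sets borel" "sigma_finite_measure \<nu>" and c: "completion \<mu> = completion \<nu>"
    and cp: "completion (\<mu> \<Otimes>\<^sub>M lborel) = completion (\<nu> \<Otimes>\<^sub>M (lborel :: real measure))"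
    and eq: "\<And>A. A \<in> sets borel \<Longrightarrow> A \<in> sets \<mu> \<and> emeasure \<mu> A = emeasure \<nu> A"
    using radon_measure_borel_part[OF assms(1)] by blast
  interpret out: invariant_flow \<Phi> \<Omega> \<nu> by (rule invariant_flowI[OF fd assms(4) \<nu> eq])
  let ?\<Psi> = "\<lambda>x t. \<Phi> x (- t)"
  \<comment> \<open>The incoming boundary is the outgoing boundary of the reversed flow.\<close>
  interpret inc: invariant_flow ?\<Psi> \<Omega> \<nu> by (rule out.reverse_invariant)
  have mu_T: "mu_T \<mu> \<Omega> T = mu_T \<nu> \<Omega> T" for T by (simp add: mu_T_def cp)
  have int: "interior_integral_exists \<Omega> \<mu> b g = interior_integral_exists \<Omega> \<nu> b g" for b g
    unfolding interior_integral_exists_def c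
    by (subst (1 2) AE_completion_iff[symmetric]) (simp only: c)
  define out_rep where "out_rep P T f \<longleftrightarrow> outgoing_representation \<Phi> \<Omega> \<nu> (\<lambda>t. t) P T f" for P T and f :: "(real^'n) \<times> real \<Rightarrow> real"
  define inc_rep where "inc_rep P T f \<longleftrightarrow> outgoing_representation ?\<Psi> \<Omega> \<nu> (\<lambda>t. T - t) P T f" for P T and f :: "(real^'n) \<times> real \<Rightarrow> real"
  let ?H = "\<lambda>(\<mu>p, \<mu>m). borel_measure_on (Gamma_plus \<Phi> \<Omega>) \<mu>p \<and> borel_measure_on (Gamma_minus \<Phi> \<Omega>) \<mu>m \<and>
    (\<forall>T::real. 0 < T \<longrightarrow> (\<forall>f :: (real ^ 'n) \<times> real \<Rightarrow> real. integrable (mu_T \<nu> \<Omega> T) f \<longrightarrow>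
      out_rep \<mu>p T f \<and> inc_rep \<mu>m T f))"
  have bd: "Gamma_minus \<Phi> \<Omega> = Gamma_plus ?\<Psi> \<Omega>" by (simp add: exit_boundary_reverse)
  have "\<exists>!z. ?H z"
  proof (rule ex1I)
    show "?H (out.outflow, inc.outflow)"
      using out.borel_measure_on_outflow inc.borel_measure_on_outflow
        out.outflow_representation[of "\<lambda>t. t"] inc.outflow_representation[of "\<lambda>t. T - t" T for T]
      unfolding bd out_rep_def inc_rep_def by auto
    fix z assume "?H z"
    moreover obtain P Q where z: "z = (P, Q)" by force
    ultimately have P: "borel_measure_on (Gamma_plus \<Phi> \<Omega>) P"
        "\<And>f. integrable (mu_T \<nu> \<Omega> 1) f \<Longrightarrow> outgoing_representation \<Phi> \<Omega> \<nu> (\<lambda>t. t) P 1 f"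
      and Q: "borel_measure_on (Gamma_plus ?\<Psi> \<Omega>) Q"
        "\<And>f. integrable (mu_T \<nu> \<Omega> 1) f \<Longrightarrow> outgoing_representation ?\<Psi> \<Omega> \<nu> (\<lambda>t. 1 - t) Q 1 f"
      unfolding bd out_rep_def inc_rep_def by auto
    have "P = out.outflow"
      by (rule out.outflow_unique[OF _ P out.borel_measure_on_outflow])
         (auto intro: out.outflow_representation)
    moreover have "Q = inc.outflow"
      by (rule inc.outflow_unique[OF _ Q inc.borel_measure_on_outflow])
         (auto intro: inc.outflow_representation)
    ultimately show "z = (out.outflow, inc.outflow)" by (simp add: z)
  qed
  then show ?thesis
    unfolding out_rep_def inc_rep_def outgoing_representation_def mu_T int c
    by (simp add: curve_length_reverse exit_time_reverse)
qed

end
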